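(* Let $\boldsymbol n=(n_1,n_2)\in\mathbb Z_{\ge0}^2$, $N=n_1+n_2$, and let $P_{\boldsymbol n}$ be a monic polynomial of degree $N$ satisfying $$\int_{\Delta_i}x^jP_{\boldsymbol n}(x)w_i(x)\,dx\begin{cases}=0,&j\le n_i-1,\\ \ne0,&j=n_i,\end{cases}\qquad i=1,2.$$ The function $$R_{\boldsymbol n}:=A_2v_2\,\mathcal L_1[q_{\boldsymbol n,2}]=-A_1v_1\,\mathcal L_2[q_{\boldsymbol n,1}]=(A_1A_2v_1v_2)\,\mathfrak{Wrons}[P_{\boldsymbol n},q_{\boldsymbol n,1},q_{\boldsymbol n,2}]$$ is a polynomial of degree $\le2\sigma_1+2\sigma_2+3$. If $A_1=A_2=:A$, then $A$ is a factor of $R_{\boldsymbol n}$. If in addition $B_1=B_2$, then $A^2$ is a factor of $R_{\boldsymbol n}$, i.e. $$R_{\boldsymbol n}^*:=\frac{R_{\boldsymbol n}}{A^2}=v^2\,\mathfrak{Wrons}[P_{\boldsymbol n},q_{\boldsymbol n,1},q_{\boldsymbol n,2}],\qquad v:=Aw,$$ is a polynomial.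
   Context: Two semiclassical weights. For $i=1,2$: $A_i$ (monic) and $B_i$ are real polynomials; $\Delta_i\subset\mathbb R$ is a finite union of non-overlapping intervals joining real zeros of $A_i$ and possibly $\infty$ (with no zero of $A_i$ in the interior of these intervals); $w_i(z)=\exp\left(\int^z\frac{B_i(t)}{A_i(t)}dt\right)$ is a (multivalued) analytic function, and on each interval of $\Delta_i$ the weight, also denoted $w_i$, is positive and coincides up to a non-zero multiplicative constant with a boundary value $(w_i)_+$ of this function. Thus $w_i'/w_i=B_i/A_i$. Put $v_i=A_iw_i$. All moments are finite: $\int_{\Delta_i}|x|^m|w_i(x)|dx<+\infty$, $m=0,1,2,\dots$; as a consequence $z^mv_i(z)=0$ (in the limit sense) at the endpoints of every subinterval of $\Delta_i$. Put $\sigma_i=\max\{\deg(A_i)-2,\deg(B_i)-1\}$, assumed $\ge0$. When $A_1=A_2=A$ and $B_1=B_2=B$, the analytic functions $w_1,w_2$ are normalized so that $w_1(z)=w_2(z)=w(z)=\exp\left(\int^z\frac{B(t)}{A(t)}dt\right)$ for every selection of the branch. Functions of the second kind: $q_{\boldsymbol n,i}(z)=\frac1{w_i(z)}\int_{\Delta_i}\frac{P_{\boldsymbol n}(t)w_i(t)}{t-z}dt$. $\mathfrak{Wrons}[f_1,\dots,f_k]=\det\left(f_j^{(i-1)}\right)_{i,j=1}^k$ is the Wronskian determinant (row $i$ contains the derivatives of order $i-1$). Differential operators: $\mathcal L_i[y]:=(A_iv_i)\,\mathfrak{Wrons}[y,P_{\boldsymbol n},q_{\boldsymbol n,i}]$,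 $i=1,2$. Standing assumption: $\mathfrak{Wrons}[P_{\boldsymbol n},q_{\boldsymbol n,1},q_{\boldsymbol n,2}]\not\equiv0$. *)

theory Defs
  imports
    "HOL-Complex_Analysis.Complex_Analysis"
    "HOL-Computational_Algebra.Polynomial"
    "Jordan_Normal_Form.Determinant"
begin

abbreviation cpoly :: "real poly \<Rightarrow> complex poly" where
  "cpoly \<equiv> map_poly complex_of_real"

text \<open>
  A branch, on the domain \<open>U\<close>, of the multivalued analytic function
  \<open>exp (\<integral>\<^sup>z B(t)/A(t) dt)\<close>. The constant of integration is left free, so the
  branches in this sense are exactly the constant non-zero multiples of the local determinations
  of any one normalisation of that function.
\<close>
definition weight_branch ::
    "real poly \<Rightarrow> real poly \<Rightarrow> complex set \<Rightarrow> (complex \<Rightarrow> complex) \<Rightarrow> bool" where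
  "weight_branch A B U w \<longleftrightarrow>
     open U \<and> connected U \<and> (\<forall>z\<in>U. poly (cpoly A) z \<noteq> 0) \<and>
     (\<exists>g. \<forall>z\<in>U. (g has_field_derivative (poly (cpoly B) z / poly (cpoly A) z)) (at z)
                 \<and> w z = exp (g z))"

text \<open>
  \<open>f\<close> is the boundary value, from the upper half plane, on \<open>J\<close> of such a branch.
  The branch need only be defined near \<open>J\<close>, because \<open>A\<close> may have non-real zeros.
\<close>
definition weight_boundary_value ::
    "real poly \<Rightarrow> real poly \<Rightarrow> real set \<Rightarrow> (real \<Rightarrow> complex) \<Rightarrow> bool" where
  "weight_boundary_value A B J f \<longleftrightarrow>
     (\<exists>U w. U \<subseteq> {z. Im z > 0} \<and> weight_branch A B U w \<and>
        (\<forall>x\<in>J. (\<forall>\<^sub>F z in at (complex_of_real x) within {z. Im z > 0}. z \<in> U) \<and>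
               (w \<longlongrightarrow> f x) (at (complex_of_real x) within {z. Im z > 0})))"

text \<open>A finite union of intervals is represented by the set of pairs of endpoints of its members.\<close>
definition support_of :: "(ereal \<times> ereal) set \<Rightarrow> real set" where
  "support_of E = (\<Union>(a, b)\<in>E. {x. a \<le> ereal x \<and> ereal x \<le> b})"

definition admissible_intervals :: "real poly \<Rightarrow> (ereal \<times> ereal) set \<Rightarrow> bool" where
  "admissible_intervals A E \<longleftrightarrow>
     finite E \<and>
     (\<forall>(a, b)\<in>E. a < b \<and>
        (a = -\<infinity> \<or> (\<exists>r. a = ereal r \<and> poly A r = 0)) \<and>
        (b = \<infinity> \<or> (\<exists>r. b = ereal r \<and> poly A r = 0)) \<and>
        (\<forall>x\<in>einterval a b. poly A x \<noteq> 0)) \<and>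
     disjoint_family_on (\<lambda>(a, b). einterval a b) E"

text \<open>
  With the convention \<open>degree 0 = 0\<close> the zero polynomial \<open>B\<close> contributes \<open>-1\<close> instead of \<open>-\<infinity>\<close>,
  which is immaterial as soon as \<open>class_index A B \<ge> 0\<close> holds.
\<close>
definition class_index :: "real poly \<Rightarrow> real poly \<Rightarrow> int" where
  "class_index A B = max (int (degree A) - 2) (int (degree B) - 1)"

text \<open>
  Here \<open>\<omega>\<close> is the weight on the real line, as opposed to the multivalued analytic function. Its
  values at the endpoints of the intervals (a null set) are unconstrained.
\<close>
definition semiclassical_weight ::
    "real poly \<Rightarrow> real poly \<Rightarrow> (ereal \<times> ereal) set \<Rightarrow> (real \<Rightarrow> real) \<Rightarrow> bool" where
  "semiclassical_weight A B E \<omega> \<longleftrightarrow>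
     lead_coeff A = 1 \<and>
     admissible_intervals A E \<and>
     (\<forall>(a, b)\<in>E. (\<forall>x\<in>einterval a b. \<omega> x > 0) \<and>
        (\<exists>f c. weight_boundary_value A B (einterval a b) f \<and> c \<noteq> 0 \<and>
               (\<forall>x\<in>einterval a b. complex_of_real (\<omega> x) = c * f x))) \<and>
     (\<forall>m::nat. set_integrable lborel (support_of E) (\<lambda>x. \<bar>x\<bar> ^ m * \<bar>\<omega> x\<bar>)) \<and>
     class_index A B \<ge> 0"

definition v_fun :: "real poly \<Rightarrow> (complex \<Rightarrow> complex) \<Rightarrow> complex \<Rightarrow> complex" where
  "v_fun A w z = poly (cpoly A) z * w z"

definition second_kind ::
    "complex poly \<Rightarrow> real set \<Rightarrow> (real \<Rightarrow> real) \<Rightarrow> (complex \<Rightarrow> complex) \<Rightarrow> complex \<Rightarrow> complex" where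
  "second_kind P \<Delta> \<omega> w z =
     1 / w z * (LINT t:\<Delta>|lborel. poly P (of_real t) * of_real (\<omega> t) / (of_real t - z))"

definition Wrons :: "(complex \<Rightarrow> complex) list \<Rightarrow> complex \<Rightarrow> complex" where
  "Wrons fs z =
     Determinant.det
       (Matrix.mat (length fs) (length fs) (\<lambda>(i, j). (deriv ^^ i) (fs ! j) z))"

definition L_op ::
    "real poly \<Rightarrow> (complex \<Rightarrow> complex) \<Rightarrow> complex poly \<Rightarrow> (complex \<Rightarrow> complex) \<Rightarrow>
     (complex \<Rightarrow> complex) \<Rightarrow> complex \<Rightarrow> complex" where
  "L_op A w P q y z = poly (cpoly A) z * v_fun A w z * Wrons [y, poly P, q] z"

definition multiple_orthogonal ::
    "complex poly \<Rightarrow> nat \<Rightarrow> real set \<Rightarrow> (real \<Rightarrow> real) \<Rightarrow> bool" where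
  "multiple_orthogonal P n \<Delta> \<omega> \<longleftrightarrow>
     (\<forall>j<n. (LINT x:\<Delta>|lborel. of_real (x ^ j) * poly P (of_real x) * of_real (\<omega> x)) = 0) \<and>
     (LINT x:\<Delta>|lborel. of_real (x ^ n) * poly P (of_real x) * of_real (\<omega> x)) \<noteq> 0"

end

theory Submission
  imports Defs "HOL-Computational_Algebra.Fundamental_Theorem_Algebra"
begin

text \<open>
  Let \<open>S\<close> be the Stieltjes transform \<open>z \<mapsto> \<integral> \<omega>(t) / (t - z) dt\<close> of one of the two weights, and let
  \<open>h\<close> be the same integral with the additional factor \<open>P(t)\<close>, so that \<open>q = h / w\<close>. The proof
  rests on two facts. As \<open>(P(t) - P(z)) / (t - z)\<close> is a polynomial in \<open>t\<close> and \<open>z\<close>, there is a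
  polynomial \<open>D\<close> with \<open>h = P S + D\<close> (\<open>cauchy_transform_poly_times\<close>). As \<open>(A \<omega>)' = (A' + B) \<omega>\<close> and
  \<open>A \<omega>\<close> vanishes at the endpoints, integration by parts shows that \<open>A S' - B S\<close> is a polynomial
  \<open>C\<close> (\<open>stieltjes_ode\<close>). Equivalently, \<open>(S / w)' = C / (A w)\<close>.

  In the Wronskian of \<open>P\<close>, \<open>q\<^sub>1\<close>, \<open>q\<^sub>2\<close> the column of \<open>q = P (S / w) + D / w\<close> may be changed by the
  multiple \<open>S / w\<close> of the column of \<open>P\<close>. By the two facts, what remains of its three entries is
  \<open>D / w\<close>, \<open>G / (A w)\<close> and \<open>X / (A\<^sup>2 w)\<close> with polynomials \<open>D\<close>, \<open>G\<close>, \<open>X\<close>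
  (\<open>weighted_transform_structure\<close>). The factor \<open>A\<^sub>1\<^sup>2 A\<^sub>2\<^sup>2 w\<^sub>1 w\<^sub>2\<close> clears all denominators, so \<open>R\<close> is
  a polynomial, given by \<open>cleared_wronskian\<close>. The two supports enter separately, so they may overlap.

  Divisibility is read off this formula: for \<open>A\<^sub>1 = A\<^sub>2 = A\<close> each of its terms contains a factor
  \<open>A\<close>. The only term without a second such factor is \<open>P A (G\<^sub>1 X\<^sub>2 - G\<^sub>2 X\<^sub>1)\<close>; but
  \<open>X \<equiv> -(A' + B) G (mod A)\<close>, so \<open>A\<close> divides \<open>G\<^sub>1 X\<^sub>2 - G\<^sub>2 X\<^sub>1\<close> as soon as also \<open>B\<^sub>1 = B\<^sub>2\<close>.

  For the degree, \<open>R\<close> is expressed by \<open>h\<^sub>1\<close>, \<open>h\<^sub>2\<close> and their derivatives instead. Orthogonality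
  gives \<open>z\<^sup>n h(z) = \<integral> t\<^sup>n P(t) \<omega>(t) / (t - z) dt\<close>, hence the \<open>j\<close>-th derivative of \<open>h\<close> is
  \<open>O(y\<^bsup>-n-1-j\<^esup>)\<close> at \<open>\<i> y\<close> as \<open>y \<rightarrow> \<infinity>\<close> (\<open>cauchy_transform_decay\<close>), and counting powers of \<open>y\<close> in the
  terms of \<open>R(\<i> y)\<close> yields the bound (\<open>growth_le_cleared_wronskian\<close>, \<open>degree_le_of_growth_le\<close>).
\<close>

section \<open>Cauchy transforms\<close>

definition cauchy_transform :: "real set \<Rightarrow> (real \<Rightarrow> complex) \<Rightarrow> complex \<Rightarrow> complex" where
  "cauchy_transform \<Delta> \<phi> z = (LINT t:\<Delta>|lborel. \<phi> t / (of_real t - z))"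

lemma norm_divide_le:
  fixes a b :: "'a::real_normed_field"
  assumes "0 < d" "d \<le> norm b"
  shows "norm (a / b) \<le> norm a * (1 / d)"
proof -
  have "norm a / norm b \<le> norm a / d"
    using assms by (intro divide_left_mono mult_pos_pos) auto
  thus ?thesis by (simp add: norm_divide)
qed

lemma closed_of_real_image:
  fixes \<Delta> :: "real set"
  assumes "closed \<Delta>" shows "closed (complex_of_real ` \<Delta>)"
proof -
  have "complex_of_real ` \<Delta> = {z. Im z = 0} \<inter> Re -` \<Delta>"
    by (auto simp: image_iff complex_eq_iff intro!: bexI[of _ "Re _"])
  moreover have "closed {z. Im z = 0}" by (intro closed_Collect_eq continuous_intros)
  moreover have "closed (Re -` \<Delta>)" using assms by (intro closed_vimage) (auto intro: continuous_intros)
  ultimately show ?thesis by auto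
qed

lemma distance_from_support:
  assumes "closed \<Delta>" "z \<notin> complex_of_real ` \<Delta>"
  obtains d where "d > 0" "\<And>t. t \<in> \<Delta> \<Longrightarrow> d \<le> norm (complex_of_real t - z)"
proof -
  obtain d where "d > 0" "\<forall>y\<in>complex_of_real ` \<Delta>. d \<le> dist z y"
    using separate_point_closed[OF closed_of_real_image[OF assms(1)] assms(2)] by auto
  thus ?thesis using that by (auto simp: dist_norm norm_minus_commute)
qed

lemma set_integrable_cauchy_kernel:
  fixes \<phi> :: "real \<Rightarrow> complex"
  assumes "set_integrable lborel \<Delta> \<phi>" "d > 0" "\<And>t. t \<in> \<Delta> \<Longrightarrow> d \<le> norm (complex_of_real t - z)"
  shows "set_integrable lborel \<Delta> (\<lambda>t. \<phi> t / (of_real t - z) ^ k)"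
  unfolding set_integrable_def
proof (rule Bochner_Integration.integrable_bound)
  let ?f = "\<lambda>t. indicator \<Delta> t *\<^sub>R \<phi> t"
  have i: "integrable lborel ?f" using assms(1) by (simp add: set_integrable_def)
  show "integrable lborel (\<lambda>t. (1 / d ^ k) *\<^sub>R ?f t)" using i by (rule integrable_scaleR_right)
  have "(\<lambda>t. ?f t / (of_real t - z) ^ k) \<in> borel_measurable lborel"
    by (intro borel_measurable_divide borel_measurable_integrable[OF i]) measurable
  thus "(\<lambda>t. indicator \<Delta> t *\<^sub>R (\<phi> t / (of_real t - z) ^ k)) \<in> borel_measurable lborel"
    by (simp add: scaleR_conv_of_real)
  show "AE t in lborel. norm (indicator \<Delta> t *\<^sub>R (\<phi> t / (of_real t - z) ^ k)) \<le> norm ((1 / d ^ k) *\<^sub>R ?f t)"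
  proof (rule AE_I2)
    fix t
    show "norm (indicator \<Delta> t *\<^sub>R (\<phi> t / (of_real t - z) ^ k)) \<le> norm ((1 / d ^ k) *\<^sub>R ?f t)"
    proof (cases "t \<in> \<Delta>")
      case True
      have "d ^ k \<le> norm (of_real t - z) ^ k" using assms True by (intro power_mono) auto
      thus ?thesis using assms(2) True
        by (auto simp: norm_divide norm_power intro!: divide_left_mono mult_pos_pos)
           (metis assms(2,3) less_le_trans norm_not_less_zero not_less_iff_gr_or_eq zero_less_power)
    qed auto
  qed
qed

text \<open>
  The difference between the difference quotient and the proposed derivative is \<open>w - z\<close> times a
  Cauchy-type integral which stays bounded as long as \<open>w\<close> keeps half the distance of \<open>z\<close> from
  the support.
\<close>

lemma has_field_derivative_cauchy_transform:
  fixes \<phi> :: "real \<Rightarrow> complex"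
  assumes \<phi>: "set_integrable lborel \<Delta> \<phi>" and \<Delta>: "closed \<Delta>" "z \<notin> complex_of_real ` \<Delta>"
  shows "(cauchy_transform \<Delta> \<phi> has_field_derivative
            (LINT t:\<Delta>|lborel. \<phi> t / (of_real t - z)\<^sup>2)) (at z)"
proof -
  obtain d where d: "d > 0" "\<And>t. t \<in> \<Delta> \<Longrightarrow> d \<le> norm (complex_of_real t - z)"
    using distance_from_support[OF \<Delta>] by blast
  define D where "D = (LINT t:\<Delta>|lborel. \<phi> t / (of_real t - z)\<^sup>2)"
  define M where "M = (LINT t:\<Delta>|lborel. norm (\<phi> t / (of_real t - z)\<^sup>2))"
  note i = set_integrable_cauchy_kernel[OF \<phi>]
  have i1: "set_integrable lborel \<Delta> (\<lambda>t. \<phi> t / (of_real t - z))" using i[OF d, of 1] by simp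
  have i2: "set_integrable lborel \<Delta> (\<lambda>t. \<phi> t / (of_real t - z)\<^sup>2)" using i[OF d, of 2] .
  have quotient_bound:
    "norm ((cauchy_transform \<Delta> \<phi> w - cauchy_transform \<Delta> \<phi> z) / (w - z) - D) \<le> norm (w - z) * (M * (2 / d))"
    if w: "w \<noteq> z" "dist w z < d / 2" for w
  proof -
    have dw: "d / 2 \<le> norm (of_real t - w)" if "t \<in> \<Delta>" for t
    proof -
      have "norm (of_real t - z) \<le> norm (of_real t - w) + norm (w - z)"
        using norm_triangle_ineq[of "of_real t - w" "w - z"] by simp
      thus ?thesis using d(2)[OF that] w(2) by (simp add: dist_norm)
    qed
    have j1: "set_integrable lborel \<Delta> (\<lambda>t. \<phi> t / (of_real t - w))"
      using i[of "d/2" w 1] d dw by simp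
    have j2: "set_integrable lborel \<Delta> (\<lambda>t. \<phi> t / (of_real t - z)\<^sup>2 / (of_real t - w))"
      using set_integrable_cauchy_kernel[OF i2, of "d/2" w 1] d dw by simp
    have eq: "(cauchy_transform \<Delta> \<phi> w - cauchy_transform \<Delta> \<phi> z) - (w - z) * D
        = (w - z)\<^sup>2 * (LINT t:\<Delta>|lborel. \<phi> t / (of_real t - z)\<^sup>2 / (of_real t - w))"
    proof -
      have "(cauchy_transform \<Delta> \<phi> w - cauchy_transform \<Delta> \<phi> z) - (w - z) * D
         = (LINT t:\<Delta>|lborel. \<phi> t / (of_real t - w) - \<phi> t / (of_real t - z) - (w - z) * (\<phi> t / (of_real t - z)\<^sup>2))"
        unfolding cauchy_transform_def D_def
        using i1 i2 j1 by (simp add: set_integral_diff set_integral_mult_right del: times_divide_eq_right)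
      also have "\<dots> = (LINT t:\<Delta>|lborel. (w - z)\<^sup>2 * (\<phi> t / (of_real t - z)\<^sup>2 / (of_real t - w)))"
      proof (rule set_lebesgue_integral_cong)
        show "\<Delta> \<in> sets lborel" using \<Delta>(1) by simp
        show "\<forall>t. t \<in> \<Delta> \<longrightarrow> \<phi> t / (of_real t - w) - \<phi> t / (of_real t - z) - (w - z) * (\<phi> t / (of_real t - z)\<^sup>2)
           = (w - z)\<^sup>2 * (\<phi> t / (of_real t - z)\<^sup>2 / (of_real t - w))"
        proof (intro allI impI)
          fix t assume t: "t \<in> \<Delta>"
          have nz: "complex_of_real t - w \<noteq> 0" "complex_of_real t - z \<noteq> 0"
            using dw[OF t] d(2)[OF t] d(1) by auto
          show "\<phi> t / (of_real t - w) - \<phi> t / (of_real t - z) - (w - z) * (\<phi> t / (of_real t - z)\<^sup>2)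
             = (w - z)\<^sup>2 * (\<phi> t / (of_real t - z)\<^sup>2 / (of_real t - w))"
          proof -
            have kernel: "p / b - p / a - (a - b) * (p / a\<^sup>2) = (a - b)\<^sup>2 * (p / a\<^sup>2 / b)"
              if "a \<noteq> 0" "b \<noteq> 0" for p a b :: complex
              using that by (simp add: field_split_simps power2_eq_square)
            have "(of_real t - z) - (of_real t - w) = w - z" by simp
            with kernel[OF nz(2) nz(1), of "\<phi> t"] show ?thesis by metis
          qed
        qed
      qed
      finally show ?thesis by (simp only: set_integral_mult_right)
    qed
    have "(cauchy_transform \<Delta> \<phi> w - cauchy_transform \<Delta> \<phi> z) / (w - z) - D
        = ((cauchy_transform \<Delta> \<phi> w - cauchy_transform \<Delta> \<phi> z) - (w - z) * D) / (w - z)"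
      using w(1) by (simp add: diff_divide_distrib)
    also have "\<dots> = (w - z) * (LINT t:\<Delta>|lborel. \<phi> t / (of_real t - z)\<^sup>2 / (of_real t - w))"
      unfolding eq using w(1) by (simp add: power2_eq_square)
    finally have "norm ((cauchy_transform \<Delta> \<phi> w - cauchy_transform \<Delta> \<phi> z) / (w - z) - D)
       = norm (w - z) * norm (LINT t:\<Delta>|lborel. \<phi> t / (of_real t - z)\<^sup>2 / (of_real t - w))"
      by (simp add: norm_mult)
    also have "norm (LINT t:\<Delta>|lborel. \<phi> t / (of_real t - z)\<^sup>2 / (of_real t - w))
        \<le> (LINT t:\<Delta>|lborel. norm (\<phi> t / (of_real t - z)\<^sup>2 / (of_real t - w)))"
      by (rule set_integral_norm_bound[OF j2])
    also have "\<dots> \<le> (LINT t:\<Delta>|lborel. norm (\<phi> t / (of_real t - z)\<^sup>2) * (2 / d))"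
    proof (rule set_integral_mono)
      show "set_integrable lborel \<Delta> (\<lambda>t. norm (\<phi> t / (of_real t - z)\<^sup>2 / (of_real t - w)))"
        by (rule set_integrable_norm[OF j2])
      show "set_integrable lborel \<Delta> (\<lambda>t. norm (\<phi> t / (of_real t - z)\<^sup>2) * (2 / d))"
        by (intro set_integrable_mult_left impI set_integrable_norm[OF i2])
      fix t assume t: "t \<in> \<Delta>"
      show "norm (\<phi> t / (of_real t - z)\<^sup>2 / (of_real t - w)) \<le> norm (\<phi> t / (of_real t - z)\<^sup>2) * (2 / d)"
        using norm_divide_le[OF _ dw[OF t], of "\<phi> t / (of_real t - z)\<^sup>2"] d(1) by simp
    qed
    also have "\<dots> = M * (2 / d)" unfolding M_def by simp
    finally show ?thesis by (simp add: mult_left_mono)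
  qed
  have "((\<lambda>w. (cauchy_transform \<Delta> \<phi> w - cauchy_transform \<Delta> \<phi> z) / (w - z) - D) \<longlongrightarrow> 0) (at z)"
  proof (rule Lim_null_comparison)
    show "\<forall>\<^sub>F w in at z. norm ((cauchy_transform \<Delta> \<phi> w - cauchy_transform \<Delta> \<phi> z) / (w - z) - D)
             \<le> norm (w - z) * (M * (2 / d))"
      unfolding eventually_at using d(1) quotient_bound by (intro exI[of _ "d/2"]) auto
    have "((\<lambda>w. norm (w - z) * (M * (2 / d))) \<longlongrightarrow> norm (z - z) * (M * (2 / d))) (at z)"
      by (intro tendsto_intros)
    thus "((\<lambda>w. norm (w - z) * (M * (2 / d))) \<longlongrightarrow> 0) (at z)" by simp
  qed
  hence "((\<lambda>w. (cauchy_transform \<Delta> \<phi> w - cauchy_transform \<Delta> \<phi> z) / (w - z)) \<longlongrightarrow> D) (at z)"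
    by (rule LIM_zero_cancel)
  thus ?thesis unfolding D_def has_field_derivative_iff .
qed

lemma cauchy_transform_holomorphic:
  assumes "set_integrable lborel \<Delta> \<phi>" "closed \<Delta>"
  shows "cauchy_transform \<Delta> \<phi> holomorphic_on - of_real ` \<Delta>"
proof (rule holomorphic_onI)
  fix z assume "z \<in> - complex_of_real ` \<Delta>"
  hence "cauchy_transform \<Delta> \<phi> field_differentiable at z"
    using has_field_derivative_cauchy_transform[OF assms] field_differentiable_def by blast
  thus "cauchy_transform \<Delta> \<phi> field_differentiable at z within - complex_of_real ` \<Delta>"
    by (rule field_differentiable_at_within)
qed

lemma cauchy_transform_times_arg:
  assumes "set_integrable lborel \<Delta> \<phi>" "set_integrable lborel \<Delta> (\<lambda>t. of_real t * \<phi> t)"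
    and \<Delta>: "closed \<Delta>" "z \<notin> complex_of_real ` \<Delta>"
  shows "cauchy_transform \<Delta> (\<lambda>t. of_real t * \<phi> t) z = z * cauchy_transform \<Delta> \<phi> z + (LINT t:\<Delta>|lborel. \<phi> t)"
proof -
  obtain d where d: "d > 0" "\<And>t. t \<in> \<Delta> \<Longrightarrow> d \<le> norm (complex_of_real t - z)"
    using distance_from_support[OF \<Delta>] by blast
  have i: "set_integrable lborel \<Delta> (\<lambda>t. \<phi> t / (of_real t - z))"
    using set_integrable_cauchy_kernel[OF assms(1) d, of 1] by simp
  have "cauchy_transform \<Delta> (\<lambda>t. of_real t * \<phi> t) z = (LINT t:\<Delta>|lborel. z * (\<phi> t / (of_real t - z)) + \<phi> t)"
    unfolding cauchy_transform_def
  proof (rule set_lebesgue_integral_cong)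
    show "\<Delta> \<in> sets lborel" using \<Delta>(1) by simp
    show "\<forall>t. t \<in> \<Delta> \<longrightarrow> of_real t * \<phi> t / (of_real t - z) = z * (\<phi> t / (of_real t - z)) + \<phi> t"
      using \<Delta>(2) by (auto simp: divide_simps algebra_simps)
  qed
  also have "\<dots> = z * cauchy_transform \<Delta> \<phi> z + (LINT t:\<Delta>|lborel. \<phi> t)"
    using i assms(1) by (simp add: cauchy_transform_def set_integral_add(2) del: times_divide_eq_right)
  finally show ?thesis .
qed

text \<open>
  The polynomial \<open>D(z) = \<integral> (p(t) - p(z)) / (t - z) \<phi>(t) dt\<close> is built by Horner's scheme: each step
  multiplies the density by \<open>t\<close>, and \<open>t / (t - z) = z / (t - z) + 1\<close>.
\<close>

lemma cauchy_transform_poly_times: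
  fixes p :: "complex poly"
  assumes int: "\<And>p :: complex poly. set_integrable lborel \<Delta> (\<lambda>t. poly p (of_real t) * \<phi> t)"
    and \<Delta>: "closed \<Delta>"
  shows "\<exists>D. \<forall>z. z \<notin> complex_of_real ` \<Delta> \<longrightarrow>
     cauchy_transform \<Delta> (\<lambda>t. poly p (of_real t) * \<phi> t) z = poly p z * cauchy_transform \<Delta> \<phi> z + poly D z"
proof (induction p)
  case 0
  show ?case by (intro exI[of _ 0]) (simp add: cauchy_transform_def)
next
  case (pCons a p)
  then obtain D where D: "\<And>z. z \<notin> complex_of_real ` \<Delta> \<Longrightarrow>
     cauchy_transform \<Delta> (\<lambda>t. poly p (of_real t) * \<phi> t) z = poly p z * cauchy_transform \<Delta> \<phi> z + poly D z"
    by blast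
  define \<psi> where "\<psi> = (\<lambda>t. poly p (complex_of_real t) * \<phi> t)"
  have i1: "set_integrable lborel \<Delta> \<phi>" using int[of 1] by simp
  have i2: "set_integrable lborel \<Delta> \<psi>" using int[of p] by (simp add: \<psi>_def)
  have i3: "set_integrable lborel \<Delta> (\<lambda>t. of_real t * \<psi> t)"
    using int[of "pCons 0 p"] by (simp add: \<psi>_def mult.assoc)
  show ?case
  proof (intro exI allI impI)
    fix z assume z: "z \<notin> complex_of_real ` \<Delta>"
    obtain d where d: "d > 0" "\<And>t. t \<in> \<Delta> \<Longrightarrow> d \<le> norm (complex_of_real t - z)"
      using distance_from_support[OF \<Delta> z] by blast
    have "cauchy_transform \<Delta> (\<lambda>t. poly (pCons a p) (of_real t) * \<phi> t) z
        = (LINT t:\<Delta>|lborel. a * (\<phi> t / (of_real t - z)) + of_real t * \<psi> t / (of_real t - z))"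
      unfolding cauchy_transform_def by (simp add: \<psi>_def algebra_simps add_divide_distrib)
    also have "\<dots> = a * cauchy_transform \<Delta> \<phi> z + cauchy_transform \<Delta> (\<lambda>t. of_real t * \<psi> t) z"
      unfolding cauchy_transform_def
      using set_integrable_cauchy_kernel[OF i1 d, of 1] set_integrable_cauchy_kernel[OF i3 d, of 1]
      by (subst set_integral_add) (auto simp del: times_divide_eq_right)
    also have "\<dots> = poly (pCons a p) z * cauchy_transform \<Delta> \<phi> z + poly (pCons (LINT t:\<Delta>|lborel. \<psi> t) D) z"
      unfolding cauchy_transform_times_arg[OF i2 i3 \<Delta> z] using D[OF z]
      by (simp add: \<psi>_def algebra_simps)
    finally show "cauchy_transform \<Delta> (\<lambda>t. poly (pCons a p) (of_real t) * \<phi> t) z =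
         poly (pCons a p) z * cauchy_transform \<Delta> \<phi> z + poly (pCons (LINT t:\<Delta>|lborel. \<psi> t) D) z" .
  qed
qed

text \<open>
  The vanishing moments are exactly the constants that the single multiplications by \<open>t\<close> would
  add.
\<close>

lemma cauchy_transform_power_times:
  assumes int: "\<And>k. set_integrable lborel \<Delta> (\<lambda>t. of_real t ^ k * \<phi> t)"
    and \<Delta>: "closed \<Delta>" "z \<notin> complex_of_real ` \<Delta>"
    and orth: "\<And>j. j < n \<Longrightarrow> (LINT t:\<Delta>|lborel. of_real t ^ j * \<phi> t) = 0"
  shows "cauchy_transform \<Delta> (\<lambda>t. of_real t ^ n * \<phi> t) z = z ^ n * cauchy_transform \<Delta> \<phi> z"
  using orth
proof (induction n)
  case (Suc n)
  have "cauchy_transform \<Delta> (\<lambda>t. of_real t * (of_real t ^ n * \<phi> t)) z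
     = z * cauchy_transform \<Delta> (\<lambda>t. of_real t ^ n * \<phi> t) z + (LINT t:\<Delta>|lborel. of_real t ^ n * \<phi> t)"
    using int[of n] int[of "Suc n"] \<Delta> by (intro cauchy_transform_times_arg) (auto simp: mult.assoc)
  thus ?case using Suc by (simp add: mult.assoc)
qed simp

text \<open>
  On the disc of radius \<open>y / 2\<close> around \<open>\<i> y\<close> both \<open>\<bar>z\<bar>\<close> and the distance from the real line are at
  least \<open>y / 2\<close>. There \<open>z\<^sup>n\<close> times the transform is the transform of \<open>t\<^sup>n \<phi>(t)\<close>, which is at most
  \<open>2 M / y\<close> for \<open>M\<close> the integral of \<open>\<bar>t\<^sup>n \<phi>(t)\<bar>\<close>; Cauchy's inequality then covers the derivatives.
\<close>

lemma cauchy_transform_decay: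
  assumes int: "\<And>k. set_integrable lborel \<Delta> (\<lambda>t. of_real t ^ k * \<phi> t)"
    and \<Delta>: "closed \<Delta>"
    and orth: "\<And>j. j < n \<Longrightarrow> (LINT t:\<Delta>|lborel. of_real t ^ j * \<phi> t) = 0"
  obtains M where "\<And>y j. y > 0 \<Longrightarrow>
     norm ((deriv ^^ j) (cauchy_transform \<Delta> \<phi>) (\<i> * of_real y)) \<le> fact j * M * (2 / y) ^ (n + 1 + j)"
proof -
  define M where "M = (LINT t:\<Delta>|lborel. norm (of_real t ^ n * \<phi> t))"
  show ?thesis
  proof (rule that)
    fix y :: real and j :: nat assume y: "y > 0"
    have off: "z \<notin> complex_of_real ` \<Delta>" if "Im z \<noteq> 0" for z using that by auto
    have upper: "Im z \<ge> y / 2 \<and> norm z \<ge> y / 2" if "norm (\<i> * of_real y - z) \<le> y / 2" for z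
    proof -
      have "\<bar>Im (\<i> * of_real y - z)\<bar> \<le> y / 2" using abs_Im_le_cmod that order_trans by blast
      hence "\<bar>y - Im z\<bar> \<le> y / 2" by simp
      hence "Im z \<ge> y / 2" by linarith
      thus ?thesis using abs_Im_le_cmod[of z] by linarith
    qed
    have i1: "set_integrable lborel \<Delta> \<phi>" using int[of 0] by simp
    have der: "cauchy_transform \<Delta> \<phi> field_differentiable (at z)" if "Im z \<noteq> 0" for z
      using has_field_derivative_cauchy_transform[OF i1 \<Delta> off[OF that]] field_differentiable_def by blast
    have holo: "cauchy_transform \<Delta> \<phi> holomorphic_on cball (\<i> * of_real y) (y / 2)"
    proof (rule holomorphic_onI)
      fix z assume "z \<in> cball (\<i> * of_real y) (y / 2)"
      hence "Im z \<noteq> 0" using upper[of z] y by (simp add: dist_norm)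
      thus "cauchy_transform \<Delta> \<phi> field_differentiable at z within cball (\<i> * of_real y) (y / 2)"
        using der field_differentiable_at_within by blast
    qed
    have "norm ((deriv ^^ j) (cauchy_transform \<Delta> \<phi>) (\<i> * of_real y)) \<le> fact j * (M * (2 / y) ^ (n + 1)) / (y / 2) ^ j"
    proof (rule Cauchy_inequality)
      show "cauchy_transform \<Delta> \<phi> holomorphic_on ball (\<i> * of_real y) (y / 2)"
        using holo holomorphic_on_subset ball_subset_cball by blast
      show "continuous_on (cball (\<i> * of_real y) (y / 2)) (cauchy_transform \<Delta> \<phi>)"
        using holo by (rule holomorphic_on_imp_continuous_on)
      show "0 < y / 2" using y by simp
      fix z assume "norm (\<i> * of_real y - z) = y / 2"
      hence z: "Im z \<ge> y / 2" "norm z \<ge> y / 2" using upper[of z] by auto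
      have d: "y / 2 \<le> norm (complex_of_real t - z)" for t
        using abs_Im_le_cmod[of "of_real t - z"] z(1) by simp
      have nz: "z \<notin> complex_of_real ` \<Delta>" using z y by (intro off) auto
      have k: "set_integrable lborel \<Delta> (\<lambda>t. of_real t ^ n * \<phi> t / (of_real t - z))"
        using set_integrable_cauchy_kernel[OF int[of n], of "y/2" z 1] d y by simp
      have "norm z ^ n * norm (cauchy_transform \<Delta> \<phi> z) = norm (cauchy_transform \<Delta> (\<lambda>t. of_real t ^ n * \<phi> t) z)"
        using cauchy_transform_power_times[OF int \<Delta> nz orth] by (simp add: norm_mult norm_power)
      also have "\<dots> \<le> (LINT t:\<Delta>|lborel. norm (of_real t ^ n * \<phi> t / (of_real t - z)))"
        unfolding cauchy_transform_def by (rule set_integral_norm_bound[OF k])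
      also have "\<dots> \<le> (LINT t:\<Delta>|lborel. norm (of_real t ^ n * \<phi> t) * (2 / y))"
      proof (rule set_integral_mono)
        show "set_integrable lborel \<Delta> (\<lambda>t. norm (of_real t ^ n * \<phi> t / (of_real t - z)))"
          by (rule set_integrable_norm[OF k])
        show "set_integrable lborel \<Delta> (\<lambda>t. norm (of_real t ^ n * \<phi> t) * (2 / y))"
          by (intro set_integrable_mult_left impI set_integrable_norm[OF int])
        fix t
        show "norm (of_real t ^ n * \<phi> t / (of_real t - z)) \<le> norm (of_real t ^ n * \<phi> t) * (2 / y)"
          using norm_divide_le[OF _ d] y by simp
      qed
      also have "\<dots> = M * (2 / y)" by (simp add: M_def)
      finally have b: "norm z ^ n * norm (cauchy_transform \<Delta> \<phi> z) \<le> M * (2 / y)" .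
      have "(y / 2) ^ n \<le> norm z ^ n" using z y by (intro power_mono) auto
      hence "(y / 2) ^ n * norm (cauchy_transform \<Delta> \<phi> z) \<le> M * (2 / y)"
        using b by (meson mult_right_mono norm_ge_zero order_trans)
      hence "norm (cauchy_transform \<Delta> \<phi> z) \<le> M * (2 / y) / (y / 2) ^ n"
        using y by (simp add: pos_le_divide_eq mult_ac)
      thus "norm (cauchy_transform \<Delta> \<phi> z) \<le> M * (2 / y) ^ (n + 1)"
        by (simp add: power_divide mult_ac)
    qed
    also have "\<dots> = fact j * M * (2 / y) ^ (n + 1 + j)"
      by (simp add: power_divide power_add mult_ac)
    finally show "norm ((deriv ^^ j) (cauchy_transform \<Delta> \<phi>) (\<i> * of_real y)) \<le> fact j * M * (2 / y) ^ (n + 1 + j)" .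
  qed
qed

section \<open>Weights near the endpoints of their intervals\<close>

lemma not_integrable_inverse_left:
  fixes \<beta> b :: real
  assumes "\<beta> < b"
  shows "\<not> set_integrable lborel {\<beta><..<b} (\<lambda>t. 1 / (b - t))"
proof
  assume int: "set_integrable lborel {\<beta><..<b} (\<lambda>t. 1 / (b - t))"
  define I where "I = (LINT t:{\<beta><..<b}|lborel. 1 / (b - t))"
  define m where "m = (\<beta> + b) / 2"
  \<comment> \<open>with this \<open>s\<close> the integral over \<open>{m..s}\<close> is \<open>ln (b - m) - ln (b - s) = \<bar>I\<bar> + 1\<close>\<close>
  define s where "s = b - (b - m) * exp (- (\<bar>I\<bar> + 1))"
  have m: "\<beta> < m" "m < b" using assms by (auto simp: m_def)
  have "(b - m) * exp (- (\<bar>I\<bar> + 1)) < (b - m) * 1"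
    using m by (intro mult_strict_left_mono) auto
  moreover have "(b - m) * exp (- (\<bar>I\<bar> + 1)) > 0" using m by simp
  ultimately have s: "m < s" "s < b" by (simp_all add: s_def)
  have "has_bochner_integral lborel (\<lambda>t. (1 / (b - t)) * indicator {m..s} t) ((- ln (b - s)) - (- ln (b - m)))"
  proof (rule has_bochner_integral_FTC_Icc_nonneg)
    show "(\<lambda>t. 1 / (b - t)) \<in> borel_measurable borel" by measurable
    show "((\<lambda>t. - ln (b - t)) has_real_derivative 1 / (b - t)) (at t)" if "t \<in> {m..s}" for t
      using that s by (auto intro!: derivative_eq_intros simp: divide_simps)
    show "0 \<le> 1 / (b - t)" if "t \<in> {m..s}" for t using that s by auto
    show "m \<le> s" using s by simp
  qed
  hence eq: "integrable lborel (\<lambda>t. (1 / (b - t)) * indicator {m..s} t)"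
     "(\<integral>t. (1 / (b - t)) * indicator {m..s} t \<partial>lborel) = ln (b - m) - ln (b - s)"
    by (auto simp: has_bochner_integral_iff)
  have "ln (b - m) - ln (b - s) \<le> I"
    unfolding eq(2)[symmetric] I_def set_lebesgue_integral_def
  proof (rule integral_mono)
    show "integrable lborel (\<lambda>t. indicator {\<beta><..<b} t *\<^sub>R (1 / (b - t)))"
      using int by (simp add: set_integrable_def)
    show "(1 / (b - t)) * indicator {m..s} t \<le> indicator {\<beta><..<b} t *\<^sub>R (1 / (b - t))" for t
      using m s by (auto simp: indicator_def)
  qed (rule eq(1))
  moreover have "ln (b - m) - ln (b - s) = \<bar>I\<bar> + 1"
    using m by (simp add: s_def ln_mult)
  ultimately show False by linarith
qed

lemma not_integrable_inverse_right:
  fixes \<beta> b :: real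
  assumes "b < \<beta>"
  shows "\<not> set_integrable lborel {b<..<\<beta>} (\<lambda>t. 1 / (t - b))"
proof
  assume "set_integrable lborel {b<..<\<beta>} (\<lambda>t. 1 / (t - b))"
  hence "integrable lborel (\<lambda>t. indicator {b<..<\<beta>} (0 + (-1) * t) *\<^sub>R (1 / ((0 + (-1) * t) - b)))"
    unfolding set_integrable_def by (rule lborel_integrable_real_affine) simp
  also have "(\<lambda>t. indicator {b<..<\<beta>} (0 + (-1) * t) *\<^sub>R (1 / ((0 + (-1) * t) - b)))
     = (\<lambda>t. indicator {-\<beta><..<-b} t *\<^sub>R (1 / (-b - t)))"
    by (auto simp: indicator_def fun_eq_iff)
  finally show False
    using not_integrable_inverse_left[of "-\<beta>" "-b"] assms by (simp add: set_integrable_def)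
qed

lemma not_integrable_infinite_interval:
  assumes "\<bar>a\<bar> = \<infinity> \<or> \<bar>b\<bar> = \<infinity>" "a < b"
  shows "\<not> set_integrable lborel (einterval a b) (\<lambda>t. 1 :: real)"
proof
  assume "set_integrable lborel (einterval a b) (\<lambda>t. 1 :: real)"
  hence fin: "emeasure lborel (einterval a b) < \<infinity>"
    by (simp add: set_integrable_def integrable_indicator_iff)
  obtain c where c: "a < ereal c" "ereal c < b" using assms(2) ereal_dense2 by blast
  \<comment> \<open>an infinite interval contains intervals of every finite length\<close>
  have "\<exists>e. \<forall>n::nat. {e n..e n + real n} \<subseteq> einterval a b"
  proof (cases "b = \<infinity>")
    case True
    have "a < ereal t" if "c \<le> t" for t
      using c(1) that by (meson ereal_less_eq(3) less_le_trans)
    thus ?thesis using True by (intro exI[of _ "\<lambda>_. c"]) (auto simp: einterval_iff)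
  next
    case False
    hence "a = -\<infinity>" using assms by auto
    moreover have "ereal t < b" if "t \<le> c" for t
      using c(2) that by (meson ereal_less_eq(3) le_less_trans)
    ultimately show ?thesis
      by (intro exI[of _ "\<lambda>n. c - real n"]) (auto simp: einterval_iff)
  qed
  then obtain e where e: "\<And>n::nat. {e n..e n + real n} \<subseteq> einterval a b" by blast
  have "of_nat n \<le> emeasure lborel (einterval a b)" for n
    using emeasure_mono[OF e[of n], of lborel] by (simp add: ennreal_of_nat_eq_real_of_nat)
  thus False using fin ennreal_Ex_less_of_nat[of "emeasure lborel (einterval a b)"] by (auto simp: not_le[symmetric])
qed

text \<open>
  This is the vanishing of \<open>p \<phi>\<close> at an endpoint, in the weak form that \<open>p \<phi>\<close> is not bounded away
  from \<open>0\<close> near it. Otherwise the constant \<open>1\<close> would be dominated by a multiple of \<open>p \<phi>\<close>, which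
  is impossible on an infinite interval; and for an endpoint \<open>r\<close> with \<open>p = (t - r) q\<close>, the function
  \<open>1 / \<bar>t - r\<bar>\<close> would be dominated by a multiple of \<open>q \<phi>\<close>, which is integrable although
  \<open>1 / \<bar>t - r\<bar>\<close> is not. The lemma is applied to intervals that adjoin one endpoint of a larger
  interval; they are infinite or have a zero of \<open>p\<close> at that endpoint.
\<close>

lemma small_near_endpoint:
  fixes p :: "complex poly" and \<phi> :: "real \<Rightarrow> complex"
  assumes ab: "a < b"
    and int: "\<And>q. set_integrable lborel (einterval a b) (\<lambda>t. poly q (of_real t) * \<phi> t)"
    and endpoint: "\<bar>a\<bar> = \<infinity> \<or> \<bar>b\<bar> = \<infinity> \<or> poly p (of_real (real_of_ereal a)) = 0
                     \<or> poly p (of_real (real_of_ereal b)) = 0"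
    and \<epsilon>: "\<epsilon> > 0"
  shows "\<exists>t\<in>einterval a b. norm (poly p (of_real t) * \<phi> t) < \<epsilon>"
proof (rule ccontr)
  assume "\<not> ?thesis"
  hence large: "\<epsilon> \<le> norm (poly p (of_real t) * \<phi> t)" if "t \<in> einterval a b" for t
    using that by (meson not_le)
  have dominated: "set_integrable lborel (einterval a b) g"
    if meas: "g \<in> borel_measurable borel"
      and le: "\<And>t. t \<in> einterval a b \<Longrightarrow> \<epsilon> * \<bar>g t\<bar> \<le> norm (poly q (of_real t) * \<phi> t)"
    for g :: "real \<Rightarrow> real" and q
  proof (rule set_integrable_bound)
    show "set_integrable lborel (einterval a b) (\<lambda>t. complex_of_real (1 / \<epsilon>) * (poly q (of_real t) * \<phi> t))"
      using int[of q] by simp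
    show "set_borel_measurable lborel (einterval a b) g"
      unfolding set_borel_measurable_def using meas by measurable
    show "AE t in lborel. t \<in> einterval a b \<longrightarrow>
            norm (g t) \<le> norm (complex_of_real (1 / \<epsilon>) * (poly q (of_real t) * \<phi> t))"
    proof (intro AE_I2 impI)
      fix t assume "t \<in> einterval a b"
      from le[OF this] have "\<bar>g t\<bar> \<le> norm (poly q (of_real t) * \<phi> t) / \<epsilon>"
        using \<epsilon> by (simp add: pos_le_divide_eq mult.commute)
      thus "norm (g t) \<le> norm (complex_of_real (1 / \<epsilon>) * (poly q (of_real t) * \<phi> t))"
        using \<epsilon> by (simp add: norm_mult norm_divide)
    qed
  qed
  show False
  proof (cases "\<bar>a\<bar> = \<infinity> \<or> \<bar>b\<bar> = \<infinity>")
    case True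
    moreover have "set_integrable lborel (einterval a b) (\<lambda>t. 1 :: real)"
    proof (rule dominated[of _ p])
      show "\<epsilon> * \<bar>1\<bar> \<le> norm (poly p (of_real t) * \<phi> t)" if "t \<in> einterval a b" for t
        using large[OF that] by simp
    qed simp
    ultimately show False using not_integrable_infinite_interval[OF _ ab] by simp
  next
    case False
    then obtain \<alpha> \<beta> where \<alpha>\<beta>: "a = ereal \<alpha>" "b = ereal \<beta>" by (cases a; cases b) auto
    hence less: "\<alpha> < \<beta>" using ab by simp
    have root: "set_integrable lborel (einterval a b) (\<lambda>t. 1 / \<bar>t - r\<bar>)"
      if r: "poly p (complex_of_real r) = 0" and out: "r \<notin> einterval a b" for r
    proof -
      obtain q where q: "p = [:- of_real r, 1:] * q" using r by (auto simp: poly_eq_0_iff_dvd)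
      show ?thesis
      proof (rule dominated[of _ q])
        fix t assume t: "t \<in> einterval a b"
        hence tr: "\<bar>t - r\<bar> > 0" using out by auto
        have "poly p (of_real t) * \<phi> t = of_real (t - r) * (poly q (of_real t) * \<phi> t)"
          unfolding q by (simp add: algebra_simps)
        hence "norm (poly p (of_real t) * \<phi> t) = \<bar>t - r\<bar> * norm (poly q (of_real t) * \<phi> t)"
          by (simp only: norm_mult norm_of_real)
        with large[OF t] tr have "\<epsilon> / \<bar>t - r\<bar> \<le> norm (poly q (of_real t) * \<phi> t)"
          by (simp only: pos_divide_le_eq mult.commute)
        thus "\<epsilon> * \<bar>1 / \<bar>t - r\<bar>\<bar> \<le> norm (poly q (of_real t) * \<phi> t)" by simp
      qed simp
    qed
    have "poly p (of_real \<alpha>) = 0 \<or> poly p (of_real \<beta>) = 0" using endpoint \<alpha>\<beta> by simp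
    thus False
    proof
      assume "poly p (of_real \<alpha>) = 0"
      hence "set_integrable lborel {\<alpha><..<\<beta>} (\<lambda>t. 1 / \<bar>t - \<alpha>\<bar>)" using root[of \<alpha>] by (simp add: \<alpha>\<beta>)
      also have "?this \<longleftrightarrow> set_integrable lborel {\<alpha><..<\<beta>} (\<lambda>t. 1 / (t - \<alpha>))"
        by (intro set_integrable_cong) auto
      finally show False using not_integrable_inverse_right[OF less] by contradiction
    next
      assume "poly p (of_real \<beta>) = 0"
      hence "set_integrable lborel {\<alpha><..<\<beta>} (\<lambda>t. 1 / \<bar>t - \<beta>\<bar>)" using root[of \<beta>] by (simp add: \<alpha>\<beta>)
      also have "?this \<longleftrightarrow> set_integrable lborel {\<alpha><..<\<beta>} (\<lambda>t. 1 / (\<beta> - t))"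
        by (intro set_integrable_cong) auto
      finally show False using not_integrable_inverse_left[OF less] by contradiction
    qed
  qed
qed

section \<open>The differential equation of the weight on the real line\<close>

text \<open>
  Near \<open>x\<close> the function \<open>B / A\<close> has a primitive \<open>G\<close> that is holomorphic across the real line. In
  the upper half disc the branch is a constant multiple of \<open>exp G\<close>, because the quotient has
  derivative zero on a convex set. So its boundary value is the restriction of a holomorphic
  function to the line.
\<close>

lemma boundary_value_has_derivative:
  assumes f: "weight_boundary_value A B J f" and J: "open J" "x \<in> J" and nz: "poly A x \<noteq> 0"
  shows "(f has_vector_derivative (of_real (poly B x / poly A x) * f x)) (at x)"
proof -
  let ?H = "{z. Im z > 0}"
  obtain U w where U: "U \<subseteq> ?H" "weight_branch A B U w"
    and ev: "\<And>x. x \<in> J \<Longrightarrow> \<forall>\<^sub>F z in at (complex_of_real x) within ?H. z \<in> U"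
    and lim: "\<And>x. x \<in> J \<Longrightarrow> (w \<longlongrightarrow> f x) (at (complex_of_real x) within ?H)"
    using f unfolding weight_boundary_value_def by blast
  obtain g where g: "\<And>z. z \<in> U \<Longrightarrow> (g has_field_derivative (poly (cpoly B) z / poly (cpoly A) z)) (at z)"
    "\<And>z. z \<in> U \<Longrightarrow> w z = exp (g z)" using U(2) unfolding weight_branch_def by blast
  have of_real_poly: "poly (cpoly p) (of_real t) = of_real (poly p t)" for p t
    by (induction p) (simp_all add: map_poly_pCons)
  obtain r1 where r1: "r1 > 0" "\<And>z. z \<in> ?H \<Longrightarrow> z \<noteq> of_real x \<Longrightarrow> dist z (of_real x) < r1 \<Longrightarrow> z \<in> U"
    using ev[OF J(2)] unfolding eventually_at by blast
  have "isCont (poly (cpoly A)) (of_real x)" by simp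
  moreover have "poly (cpoly A) (of_real x) \<noteq> 0" using nz by (simp add: of_real_poly)
  ultimately have "\<forall>\<^sub>F z in nhds (of_real x). poly (cpoly A) z \<noteq> 0"
    unfolding isCont_def tendsto_at_iff_tendsto_nhds by (rule tendsto_imp_eventually_ne)
  then obtain r2 where r2: "r2 > 0" "\<And>z. dist z (of_real x) < r2 \<Longrightarrow> poly (cpoly A) z \<noteq> 0"
    unfolding eventually_nhds_metric by blast
  obtain r3 where r3: "r3 > 0" "ball x r3 \<subseteq> J" using J open_contains_ball by blast
  define r where "r = min r1 (min r2 r3)"
  have r: "r > 0" using r1 r2 r3 by (simp add: r_def)
  define D where "D = ball (complex_of_real x) r"
  have "(\<lambda>z. poly (cpoly B) z / poly (cpoly A) z) holomorphic_on D"
    using r2 by (intro holomorphic_intros) (auto simp: D_def r_def dist_commute)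
  then obtain G where "\<And>z. z \<in> D \<Longrightarrow> (G has_field_derivative (poly (cpoly B) z / poly (cpoly A) z)) (at z within D)"
    using holomorphic_convex_primitive'[of D] unfolding D_def by auto
  hence G: "\<And>z. z \<in> D \<Longrightarrow> (G has_field_derivative (poly (cpoly B) z / poly (cpoly A) z)) (at z)"
    unfolding D_def by (metis at_within_open open_ball)
  \<comment> \<open>convexity of the half disc makes the constant below the same throughout\<close>
  have conv: "convex (D \<inter> ?H)" unfolding D_def by (intro convex_Int convex_ball convex_halfspace_Im_gt)
  have sub: "z \<in> U" if "z \<in> D \<inter> ?H" for z
    using that r1(2)[of z] by (cases "z = of_real x") (auto simp: D_def r_def dist_commute)
  have "\<exists>k. \<forall>z\<in>D \<inter> ?H. w z * exp (- G z) = k"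
  proof (rule has_field_derivative_zero_constant[OF conv])
    fix z assume z: "z \<in> D \<inter> ?H"
    have op: "open (D \<inter> ?H)" unfolding D_def by (intro open_Int open_ball open_halfspace_Im_gt)
    have "((\<lambda>z. exp (g z) * exp (- G z)) has_field_derivative 0) (at z)"
      using z sub[OF z] by (auto intro!: derivative_eq_intros g G)
    hence "((\<lambda>z. w z * exp (- G z)) has_field_derivative 0) (at z)"
      by (rule has_field_derivative_transform_within_open) (use op z sub g(2) in auto)
    thus "((\<lambda>z. w z * exp (- G z)) has_field_derivative 0) (at z within D \<inter> ?H)"
      by (rule has_field_derivative_at_within)
  qed
  then obtain k where k: "\<And>z. z \<in> D \<inter> ?H \<Longrightarrow> w z * exp (- G z) = k" by blast
  have w_eq: "w z = k * exp (G z)" if "z \<in> D \<inter> ?H" for z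
    using k[OF that] by (simp add: exp_minus field_simps)
  have f_eq: "f t = k * exp (G (of_real t))" if t: "t \<in> ball x r" for t
  proof -
    have tD: "of_real t \<in> D" using t by (simp add: D_def dist_of_real)
    have tJ: "t \<in> J" using t r3 by (auto simp: r_def)
    \<comment> \<open>limits at real points from the upper half plane are unique\<close>
    have "of_real t islimpt ?H"
      unfolding islimpt_approachable
    proof (intro allI impI)
      fix e :: real assume "e > 0"
      thus "\<exists>z\<in>?H. z \<noteq> of_real t \<and> dist z (of_real t) < e"
        by (intro bexI[of _ "of_real t + \<i> * of_real (e / 2)"]) (auto simp: dist_norm norm_mult)
    qed
    hence nontriv: "at (complex_of_real t) within ?H \<noteq> bot" using trivial_limit_within by blast
    have "isCont G (of_real t)" using G[OF tD] by (rule DERIV_isCont)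
    hence "((\<lambda>z. k * exp (G z)) \<longlongrightarrow> k * exp (G (of_real t))) (at (of_real t) within ?H)"
      unfolding isCont_def by (intro tendsto_intros) (rule tendsto_within_subset, auto)
    moreover have "\<forall>\<^sub>F z in at (of_real t) within ?H. k * exp (G z) = w z"
    proof -
      have "\<forall>\<^sub>F z in at (of_real t) within ?H. z \<in> D"
        using tD unfolding D_def by (auto simp: eventually_at_topological intro!: exI[of _ "ball (of_real x) r"])
      moreover have "\<forall>\<^sub>F z in at (of_real t) within ?H. z \<in> ?H"
        by (auto simp: eventually_at_filter)
      ultimately show ?thesis by eventually_elim (simp add: w_eq)
    qed
    ultimately have "(w \<longlongrightarrow> k * exp (G (of_real t))) (at (of_real t) within ?H)"
      by (rule Lim_transform_eventually)
    thus ?thesis using lim[OF tJ] nontriv tendsto_unique by blast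
  qed
  have xD: "of_real x \<in> D" using r by (simp add: D_def)
  have "((\<lambda>z. k * exp (G z)) has_field_derivative
          (of_real (poly B x / poly A x) * f x)) (at (of_real x))"
    using xD r by (auto intro!: derivative_eq_intros G simp: f_eq of_real_poly)
  hence "((\<lambda>t. k * exp (G (of_real t))) has_vector_derivative (of_real (poly B x / poly A x) * f x)) (at x)"
    by (rule has_vector_derivative_real_field)
  thus ?thesis
    by (rule has_vector_derivative_transform_within_open[of _ _ _ "ball x r"]) (use r f_eq in auto)
qed

lemma semiclassical_weight_has_derivative:
  assumes w: "semiclassical_weight A B E \<omega>" and ab: "(a, b) \<in> E" and t: "t \<in> einterval a b"
  shows "((\<lambda>t. complex_of_real (\<omega> t)) has_vector_derivative
           of_real (poly B t / poly A t) * of_real (\<omega> t)) (at t)"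
proof -
  obtain f c where f: "weight_boundary_value A B (einterval a b) f"
    and eq: "\<And>x. x \<in> einterval a b \<Longrightarrow> complex_of_real (\<omega> x) = c * f x"
    using w ab unfolding semiclassical_weight_def by fast
  have nz: "poly A t \<noteq> 0" using w ab t by (auto simp: semiclassical_weight_def admissible_intervals_def)
  have "(f has_vector_derivative of_real (poly B t / poly A t) * f t) (at t)"
    by (rule boundary_value_has_derivative[OF f _ t nz]) simp
  hence "((\<lambda>t. c * f t) has_vector_derivative c * (of_real (poly B t / poly A t) * f t)) (at t)"
    by (rule has_vector_derivative_mult_right)
  hence "((\<lambda>t. complex_of_real (\<omega> t)) has_vector_derivative c * (of_real (poly B t / poly A t) * f t)) (at t)"
    by (rule has_vector_derivative_transform_within_open[where S = "einterval a b"]) (use t eq in auto)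
  thus ?thesis using eq[OF t] by (simp add: mult_ac)
qed

section \<open>Integration over the support\<close>

lemma closed_support_of:
  assumes "finite E" shows "closed (support_of E)"
proof -
  have "closed {x. a \<le> ereal x \<and> ereal x \<le> b}" for a b
    by (intro closed_Collect_conj closed_Collect_le) (auto intro!: continuous_intros continuous_on_ereal)
  thus ?thesis unfolding support_of_def using assms by (intro closed_UN) auto
qed

text \<open>
  Together with the next lemma: the support and the union of the open intervals differ by finitely
  many points only, so all integrals over the support split over the open intervals, where the
  weight is controlled.
\<close>

lemma interiors_subset_support: "(\<Union>(a, b)\<in>E. einterval a b) \<subseteq> support_of E"
  by (auto simp: support_of_def einterval_iff less_imp_le intro!: bexI)

lemma finite_support_minus_interiors:
  assumes "finite E"
  shows "finite (support_of E - (\<Union>(a, b)\<in>E. einterval a b))"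
proof (rule finite_subset)
  show "support_of E - (\<Union>(a, b)\<in>E. einterval a b) \<subseteq> real_of_ereal ` (fst ` E \<union> snd ` E)"
  proof
    fix x assume x: "x \<in> support_of E - (\<Union>(a, b)\<in>E. einterval a b)"
    then obtain a b where ab: "(a, b) \<in> E" "a \<le> ereal x" "ereal x \<le> b" by (auto simp: support_of_def)
    hence "x \<notin> einterval a b" using x by auto
    hence "ereal x = a \<or> ereal x = b" using ab by (auto simp: einterval_iff)
    hence "x = real_of_ereal a \<or> x = real_of_ereal b" by auto
    moreover have "a \<in> fst ` E \<union> snd ` E" "b \<in> fst ` E \<union> snd ` E" using ab(1) by force+
    ultimately show "x \<in> real_of_ereal ` (fst ` E \<union> snd ` E)" by blast
  qed
  show "finite (real_of_ereal ` (fst ` E \<union> snd ` E))" using assms by simp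
qed

lemma set_integral_support:
  fixes f :: "real \<Rightarrow> complex"
  assumes E: "admissible_intervals A E" and int: "set_integrable lborel (support_of E) f"
  shows "(LINT t:support_of E|lborel. f t) = (\<Sum>(a, b)\<in>E. LINT t:einterval a b|lborel. f t)"
proof -
  have fin: "finite E" and disj: "disjoint_family_on (\<lambda>(a, b). einterval a b) E"
    using E by (auto simp: admissible_intervals_def)
  have "(LINT t:support_of E|lborel. f t) = (LINT t:(\<Union>(a, b)\<in>E. einterval a b)|lborel. f t)"
  proof (rule set_integral_discrete_difference)
    show "countable (support_of E - (\<Union>(a, b)\<in>E. einterval a b))"
      by (rule countable_finite[OF finite_support_minus_interiors[OF fin]])
    show "(support_of E - (\<Union>(a, b)\<in>E. einterval a b)) \<union> ((\<Union>(a, b)\<in>E. einterval a b) - support_of E)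
        \<subseteq> support_of E - (\<Union>(a, b)\<in>E. einterval a b)"
      using interiors_subset_support[of E] by blast
  qed simp_all
  also have "\<dots> = (\<Sum>I\<in>E. LINT t:(\<lambda>(a, b). einterval a b) I|lborel. f t)"
  proof (rule set_integral_finite_Union[OF fin disj])
    fix I assume I: "I \<in> E"
    show "set_integrable lborel ((\<lambda>(a, b). einterval a b) I) f"
      by (rule set_integrable_subset[OF int]) (use I interiors_subset_support[of E] in \<open>auto split: prod.splits\<close>)
    show "(\<lambda>(a, b). einterval a b) I \<in> sets lborel" by (auto split: prod.splits)
  qed
  also have "\<dots> = (\<Sum>(a, b)\<in>E. LINT t:einterval a b|lborel. f t)" by (simp add: case_prod_unfold)
  finally show ?thesis .
qed

text \<open>
  The moment condition concerns \<open>\<bar>\<omega>\<bar>\<close>. The measurability and integrability of \<open>\<omega>\<close> itself follow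
  because \<open>\<omega> = \<bar>\<omega>\<bar>\<close> except at the finitely many endpoints.
\<close>

lemma semiclassical_integrable:
  fixes p :: "complex poly"
  assumes w: "semiclassical_weight A B E \<omega>"
  shows "set_integrable lborel (support_of E) (\<lambda>t. poly p (of_real t) * of_real (\<omega> t))"
proof -
  have fin: "finite E" and mom: "\<And>m. set_integrable lborel (support_of E) (\<lambda>x. \<bar>x\<bar> ^ m * \<bar>\<omega> x\<bar>)"
    and pos: "\<And>a b x. (a, b) \<in> E \<Longrightarrow> x \<in> einterval a b \<Longrightarrow> \<omega> x > 0"
    using w by (auto simp: semiclassical_weight_def admissible_intervals_def)
  have int: "integrable lborel (\<lambda>t. indicator (support_of E) t *\<^sub>R (\<bar>t\<bar> ^ m * \<omega> t))" for m
  proof (subst integrable_discrete_difference)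
    show "countable (support_of E - (\<Union>(a, b)\<in>E. einterval a b))"
      by (rule countable_finite[OF finite_support_minus_interiors[OF fin]])
    show "indicator (support_of E) t *\<^sub>R (\<bar>t\<bar> ^ m * \<omega> t) = indicator (support_of E) t *\<^sub>R (\<bar>t\<bar> ^ m * \<bar>\<omega> t\<bar>)"
      if "t \<notin> support_of E - (\<Union>(a, b)\<in>E. einterval a b)" for t
    proof (cases "t \<in> support_of E")
      case True
      with that obtain a b where "(a, b) \<in> E" "t \<in> einterval a b" by auto
      from pos[OF this] show ?thesis by simp
    qed simp
    show "integrable lborel (\<lambda>t. indicator (support_of E) t *\<^sub>R (\<bar>t\<bar> ^ m * \<bar>\<omega> t\<bar>))"
      using mom[of m] by (simp add: set_integrable_def)
  qed simp_all
  have monom: "integrable lborel (\<lambda>t. complex_of_real (t ^ m * (indicator (support_of E) t * \<omega> t)))" for m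
  proof (rule integrable_of_real, rule Bochner_Integration.integrable_bound[OF int[of m]])
    have "(\<lambda>t. indicator (support_of E) t *\<^sub>R (\<bar>t\<bar> ^ 0 * \<omega> t)) \<in> borel_measurable lborel"
      by (rule borel_measurable_integrable[OF int])
    thus "(\<lambda>t. t ^ m * (indicator (support_of E) t * \<omega> t)) \<in> borel_measurable lborel"
      by simp
  qed (auto simp: abs_mult power_abs)
  have "integrable lborel (\<lambda>t. \<Sum>i\<le>degree p. coeff p i * complex_of_real (t ^ i * (indicator (support_of E) t * \<omega> t)))"
    by (intro Bochner_Integration.integrable_sum integrable_mult_right monom)
  also have "(\<lambda>t. \<Sum>i\<le>degree p. coeff p i * complex_of_real (t ^ i * (indicator (support_of E) t * \<omega> t)))
     = (\<lambda>t. indicator (support_of E) t *\<^sub>R (poly p (of_real t) * of_real (\<omega> t)))"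
    by (auto simp: poly_altdef sum_distrib_right sum_distrib_left scaleR_conv_of_real mult_ac intro!: sum.cong)
  finally show ?thesis by (simp add: set_integrable_def)
qed

section \<open>The differential equation of the Stieltjes transform\<close>

text \<open>
  Choose sequences tending to either end along which \<open>F\<close> tends to \<open>0\<close>. By dominated convergence the
  integral is the limit of the integrals between their terms, and these are differences of values of
  \<open>F\<close> at the chosen points.
\<close>

lemma integral_derivative_eq_0:
  fixes f F :: "real \<Rightarrow> complex"
  assumes ab: "a < b"
    and der: "\<And>t. t \<in> einterval a b \<Longrightarrow> (F has_vector_derivative f t) (at t)"
    and cont: "continuous_on (einterval a b) f"
    and int: "set_integrable lborel (einterval a b) f"
    and upper: "\<And>c \<epsilon>. c \<in> einterval a b \<Longrightarrow> \<epsilon> > 0 \<Longrightarrow> \<exists>t. c < t \<and> ereal t < b \<and> norm (F t) < \<epsilon>"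
    and lower: "\<And>c \<epsilon>. c \<in> einterval a b \<Longrightarrow> \<epsilon> > 0 \<Longrightarrow> \<exists>t. a < ereal t \<and> t < c \<and> norm (F t) < \<epsilon>"
  shows "(LINT t:einterval a b|lborel. f t) = 0"
proof -
  obtain u l :: "nat \<Rightarrow> real" where ul: "einterval a b = (\<Union>i. {l i .. u i})"
    "incseq u" "decseq l" "\<And>i. l i < u i" "\<And>i. a < l i" "\<And>i. u i < b"
    by (rule einterval_Icc_approximation[OF ab]) (rule that)
  have ul_in: "u n \<in> einterval a b" "l n \<in> einterval a b" for n
    unfolding ul(1) using ul(4)[of n] less_imp_le by auto
  have "\<exists>s. \<forall>n. u n < s n \<and> ereal (s n) < b \<and> norm (F (s n)) < inverse (real (Suc n))"
    by (intro choice allI upper[OF ul_in(1)]) simp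
  then obtain s where s: "\<And>n. u n < s n" "\<And>n. ereal (s n) < b" "\<And>n. norm (F (s n)) < inverse (real (Suc n))"
    by blast
  have "\<exists>r. \<forall>n. a < ereal (r n) \<and> r n < l n \<and> norm (F (r n)) < inverse (real (Suc n))"
    by (intro choice allI lower[OF ul_in(2)]) simp
  then obtain r where r: "\<And>n. a < ereal (r n)" "\<And>n. r n < l n" "\<And>n. norm (F (r n)) < inverse (real (Suc n))"
    by blast
  have rs: "{r n..s n} \<subseteq> einterval a b" for n
  proof
    fix t assume "t \<in> {r n..s n}"
    hence "ereal (r n) \<le> ereal t" "ereal t \<le> ereal (s n)" by auto
    thus "t \<in> einterval a b" using less_le_trans[OF r(1)] le_less_trans[OF _ s(2)]
      unfolding einterval_iff by blast
  qed
  have FTC: "(\<integral>t. indicator {r n..s n} t *\<^sub>R f t \<partial>lborel) = F (s n) - F (r n)" for n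
  proof (rule integral_FTC_Icc)
    show "r n \<le> s n" using r(2)[of n] s(1)[of n] ul(4)[of n] by linarith
    show "continuous_on {r n..s n} f" using cont rs by (rule continuous_on_subset)
    show "(F has_vector_derivative f x) (at x within {r n..s n})" if "r n \<le> x" "x \<le> s n" for x
      using that rs[of n] by (intro has_vector_derivative_at_within[OF der]) auto
  qed
  have "(\<lambda>n. \<integral>t. indicator {r n..s n} t *\<^sub>R f t \<partial>lborel) \<longlonglongrightarrow> (\<integral>t. indicator (einterval a b) t *\<^sub>R f t \<partial>lborel)"
  proof (rule integral_dominated_convergence)
    have i: "integrable lborel (\<lambda>t. indicator (einterval a b) t *\<^sub>R f t)"
      using int by (simp add: set_integrable_def)
    thus "(\<lambda>t. indicator (einterval a b) t *\<^sub>R f t) \<in> borel_measurable lborel" by simp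
    show "integrable lborel (\<lambda>t. norm (indicator (einterval a b) t *\<^sub>R f t))" using i by (rule integrable_norm)
    show "(\<lambda>t. indicator {r n..s n} t *\<^sub>R f t) \<in> borel_measurable lborel" for n
    proof -
      have "set_integrable lborel {r n..s n} f"
        by (rule set_integrable_subset[OF int]) (use rs in auto)
      thus ?thesis by (simp add: set_integrable_def)
    qed
    show "AE t in lborel. norm (indicator {r n..s n} t *\<^sub>R f t) \<le> norm (indicator (einterval a b) t *\<^sub>R f t)" for n
      using rs[of n] by (intro AE_I2) (auto simp: indicator_def)
    show "AE t in lborel. (\<lambda>n. indicator {r n..s n} t *\<^sub>R f t) \<longlonglongrightarrow> indicator (einterval a b) t *\<^sub>R f t"
    proof (rule AE_I2)
      fix t
      show "(\<lambda>n. indicator {r n..s n} t *\<^sub>R f t) \<longlonglongrightarrow> indicator (einterval a b) t *\<^sub>R f t"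
      proof (cases "t \<in> einterval a b")
        case True
        then obtain i where i: "l i \<le> t" "t \<le> u i" unfolding ul(1) by auto
        have "t \<in> {r n..s n}" if "i \<le> n" for n
          using i s(1)[of n] r(2)[of n] incseqD[OF ul(2) that] decseqD[OF ul(3) that] by auto
        hence "\<forall>\<^sub>F n in sequentially. indicator {r n..s n} t *\<^sub>R f t = indicator (einterval a b) t *\<^sub>R f t"
          using True by (auto simp: eventually_sequentially intro!: exI[of _ i])
        thus ?thesis by (rule tendsto_eventually)
      next
        case False
        hence "t \<notin> {r n..s n}" for n using rs[of n] by blast
        thus ?thesis using False by simp
      qed
    qed
  qed
  hence "(\<lambda>n. F (s n) - F (r n)) \<longlonglongrightarrow> (LINT t:einterval a b|lborel. f t)"
    unfolding FTC set_lebesgue_integral_def .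
  moreover have "(\<lambda>n. F (s n) - F (r n)) \<longlonglongrightarrow> 0 - 0"
  proof (rule tendsto_diff)
    show "(\<lambda>n. F (s n)) \<longlonglongrightarrow> 0"
      by (rule Lim_null_comparison[OF _ LIMSEQ_inverse_real_of_nat]) (use s(3) in \<open>auto intro!: always_eventually less_imp_le\<close>)
    show "(\<lambda>n. F (r n)) \<longlonglongrightarrow> 0"
      by (rule Lim_null_comparison[OF _ LIMSEQ_inverse_real_of_nat]) (use r(3) in \<open>auto intro!: always_eventually less_imp_le\<close>)
  qed
  ultimately show ?thesis using LIMSEQ_unique by fastforce
qed

lemma poly_cpoly_of_real: "poly (cpoly p) (of_real t) = of_real (poly p t)"
  by (induction p) (simp_all add: map_poly_pCons)

text \<open>
  The integrand is the derivative of \<open>A \<omega> / (t - z)\<close>, by \<open>A \<omega>' = B \<omega>\<close>. This function is small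
  near the endpoints since \<open>A \<omega>\<close> is and \<open>\<bar>t - z\<bar>\<close> is bounded below.
\<close>

lemma integral_weight_by_parts:
  assumes w: "semiclassical_weight A B E \<omega>" and z: "z \<notin> of_real ` support_of E"
  shows "(LINT t:support_of E|lborel.
            poly (pderiv (cpoly A) + cpoly B) (of_real t) * of_real (\<omega> t) / (of_real t - z)
            - poly (cpoly A) (of_real t) * of_real (\<omega> t) / (of_real t - z)\<^sup>2) = 0"
    (is "(LINT t:_|_. ?f t) = 0")
proof -
  define \<phi> where "\<phi> = (\<lambda>t. complex_of_real (\<omega> t))"
  have E: "admissible_intervals A E" using w by (simp add: semiclassical_weight_def)
  have fin: "finite E" using E by (simp add: admissible_intervals_def)
  obtain d where d: "d > 0" "\<And>t. t \<in> support_of E \<Longrightarrow> d \<le> norm (complex_of_real t - z)"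
    using distance_from_support[OF closed_support_of[OF fin] z] by blast
  note int = semiclassical_integrable[OF w]
  have int_f: "set_integrable lborel (support_of E) ?f"
    using set_integrable_cauchy_kernel[OF int d, of _ 1] set_integrable_cauchy_kernel[OF int d, of _ 2]
    by (intro set_integral_diff(1)) (auto simp del: poly_add)
  have "(LINT t:einterval a b|lborel. ?f t) = 0" if ab: "(a, b) \<in> E" for a b
  proof (rule integral_derivative_eq_0)
    have sub: "einterval a b \<subseteq> support_of E" using interiors_subset_support[of E] ab by auto
    have off: "complex_of_real t - z \<noteq> 0" if "t \<in> einterval a b" for t
      using d sub that by fastforce
    show less: "a < b" using E ab by (auto simp: admissible_intervals_def)
    have \<phi>': "(\<phi> has_vector_derivative of_real (poly B t / poly A t) * \<phi> t) (at t)"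
      if "t \<in> einterval a b" for t
      using semiclassical_weight_has_derivative[OF w ab that] by (simp add: \<phi>_def)
    show "((\<lambda>t. poly (cpoly A) (of_real t) / (of_real t - z) * \<phi> t) has_vector_derivative ?f t) (at t)"
      if t: "t \<in> einterval a b" for t
    proof -
      have nz: "poly A t \<noteq> 0" using E ab t by (auto simp: admissible_intervals_def)
      have "((\<lambda>s. poly (cpoly A) s / (s - z)) has_field_derivative
              (poly (pderiv (cpoly A)) (of_real t) * (of_real t - z) - poly (cpoly A) (of_real t) * 1)
               / ((of_real t - z) * (of_real t - z))) (at (of_real t))"
        using off[OF t] by (intro DERIV_divide poly_DERIV) (auto intro!: derivative_eq_intros)
      hence R: "((\<lambda>t. poly (cpoly A) (of_real t) / (of_real t - z)) has_vector_derivative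
              (poly (pderiv (cpoly A)) (of_real t) * (of_real t - z) - poly (cpoly A) (of_real t) * 1)
               / ((of_real t - z) * (of_real t - z))) (at t)"
        by (rule has_vector_derivative_real_field)
      have kernel: "a0 / s * (b0 / a0 * p) + (a1 * s - a0 * 1) / (s * s) * p = (a1 + b0) * p / s - a0 * p / s\<^sup>2"
        if "s \<noteq> 0" "a0 \<noteq> 0" for a0 a1 b0 p s :: complex
        using that by (simp add: field_split_simps power2_eq_square)
      have A0: "poly (cpoly A) (of_real t) \<noteq> 0" using nz by (simp add: poly_cpoly_of_real)
      have "of_real (poly B t / poly A t) = poly (cpoly B) (of_real t) / poly (cpoly A) (of_real t)"
        by (simp add: poly_cpoly_of_real)
      with has_vector_derivative_mult[OF R \<phi>'[OF t]] kernel[OF off[OF t] A0]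
      show ?thesis by (simp only: poly_add \<phi>_def)
    qed
    show "continuous_on (einterval a b) ?f"
    proof -
      have "continuous_on (einterval a b) \<phi>"
        using \<phi>' has_vector_derivative_continuous by (intro continuous_at_imp_continuous_on) blast
      thus ?thesis unfolding \<phi>_def using off by (intro continuous_intros) auto
    qed
    show "set_integrable lborel (einterval a b) ?f"
      by (rule set_integrable_subset[OF int_f _ sub]) simp
    have small: "\<exists>t\<in>einterval a' b'. norm (poly (cpoly A) (of_real t) / (of_real t - z) * \<phi> t) < \<epsilon>"
      if "\<epsilon> > 0" "einterval a' b' \<subseteq> einterval a b" "a' < b'"
         "\<bar>a'\<bar> = \<infinity> \<or> \<bar>b'\<bar> = \<infinity> \<or> poly A (real_of_ereal a') = 0 \<or> poly A (real_of_ereal b') = 0" for \<epsilon> a' b'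
    proof -
      have "\<exists>t\<in>einterval a' b'. norm (poly (cpoly A) (of_real t) * \<phi> t) < \<epsilon> * d"
      proof (rule small_near_endpoint)
        show "set_integrable lborel (einterval a' b') (\<lambda>t. poly q (of_real t) * \<phi> t)" for q
          unfolding \<phi>_def by (rule set_integrable_subset[OF int]) (use that(2) sub in auto)
      qed (use that d(1) in \<open>auto simp: poly_cpoly_of_real\<close>)
      then obtain t where t: "t \<in> einterval a' b'" "norm (poly (cpoly A) (of_real t) * \<phi> t) < \<epsilon> * d" by blast
      have "norm (poly (cpoly A) (of_real t) * \<phi> t / (of_real t - z)) \<le> norm (poly (cpoly A) (of_real t) * \<phi> t) * (1 / d)"
        using t(1) that(2) sub d by (intro norm_divide_le) auto
      also have "\<dots> < \<epsilon>" using t(2) d(1) by (simp add: pos_divide_less_eq)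
      finally show ?thesis using t(1) by auto
    qed
    have ends: "a = -\<infinity> \<or> (\<exists>r. a = ereal r \<and> poly A r = 0)" "b = \<infinity> \<or> (\<exists>r. b = ereal r \<and> poly A r = 0)"
      using E ab by (auto simp: admissible_intervals_def)
    show "\<exists>t. c < t \<and> ereal t < b \<and> norm (poly (cpoly A) (of_real t) / (of_real t - z) * \<phi> t) < \<epsilon>"
      if c: "c \<in> einterval a b" and \<epsilon>: "\<epsilon> > 0" for c \<epsilon>
    proof -
      have "einterval c b \<subseteq> einterval a b"
        using c by (auto simp: einterval_iff) (metis less_trans less_ereal.simps(1))
      moreover have "ereal c < b" using c by (simp add: einterval_iff)
      ultimately obtain t where "t \<in> einterval c b"
          "norm (poly (cpoly A) (of_real t) / (of_real t - z) * \<phi> t) < \<epsilon>"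
        using small[of \<epsilon> c b] \<epsilon> ends(2) by auto
      thus ?thesis by (intro exI[of _ t]) (simp add: einterval_iff)
    qed
    show "\<exists>t. a < ereal t \<and> t < c \<and> norm (poly (cpoly A) (of_real t) / (of_real t - z) * \<phi> t) < \<epsilon>"
      if c: "c \<in> einterval a b" and \<epsilon>: "\<epsilon> > 0" for c \<epsilon>
    proof -
      have "einterval a c \<subseteq> einterval a b"
        using c by (auto simp: einterval_iff) (metis less_trans less_ereal.simps(1))
      moreover have "a < ereal c" using c by (simp add: einterval_iff)
      ultimately obtain t where "t \<in> einterval a c"
          "norm (poly (cpoly A) (of_real t) / (of_real t - z) * \<phi> t) < \<epsilon>"
        using small[of \<epsilon> a c] \<epsilon> ends(1) by auto
      thus ?thesis by (intro exI[of _ t]) (simp add: einterval_iff)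
    qed
  qed
  thus ?thesis unfolding set_integral_support[OF E int_f] by (auto intro!: sum.neutral)
qed

text \<open>
  By \<open>cauchy_transform_poly_times\<close>, the transform of \<open>A \<omega>\<close> is \<open>A S + D\<^sub>1\<close> and the transform of
  \<open>(A' + B) \<omega>\<close> is \<open>(A' + B) S + D\<^sub>2\<close>. Integration by parts says that the second is the derivative of
  the first; therefore \<open>A S' - B S = D\<^sub>2 - D\<^sub>1'\<close>.
\<close>

lemma stieltjes_ode:
  assumes w: "semiclassical_weight A B E \<omega>"
  defines "S \<equiv> cauchy_transform (support_of E) (\<lambda>t. of_real (\<omega> t))"
  shows "\<exists>C. \<forall>z. z \<notin> of_real ` support_of E \<longrightarrow>
           poly (cpoly A) z * deriv S z - poly (cpoly B) z * S z = poly C z"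
proof -
  define \<Delta> where "\<Delta> = support_of E"
  define \<phi> where "\<phi> = (\<lambda>t. complex_of_real (\<omega> t))"
  have closed: "closed \<Delta>"
    using w by (auto simp: \<Delta>_def semiclassical_weight_def admissible_intervals_def intro: closed_support_of)
  have int: "set_integrable lborel \<Delta> (\<lambda>t. poly p (of_real t) * \<phi> t)" for p
    unfolding \<Delta>_def \<phi>_def by (rule semiclassical_integrable[OF w])
  have S: "S = cauchy_transform \<Delta> \<phi>" by (simp add: S_def \<Delta>_def \<phi>_def)
  define p where "p = cpoly A"
  define q where "q = pderiv (cpoly A) + cpoly B"
  obtain D1 where D1: "\<And>z. z \<notin> of_real ` \<Delta> \<Longrightarrow>
      cauchy_transform \<Delta> (\<lambda>t. poly p (of_real t) * \<phi> t) z = poly p z * S z + poly D1 z"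
    using cauchy_transform_poly_times[OF int closed, of p] unfolding S by blast
  obtain D2 where D2: "\<And>z. z \<notin> of_real ` \<Delta> \<Longrightarrow>
      cauchy_transform \<Delta> (\<lambda>t. poly q (of_real t) * \<phi> t) z = poly q z * S z + poly D2 z"
    using cauchy_transform_poly_times[OF int closed, of q] unfolding S by blast
  have "poly (cpoly A) z * deriv S z - poly (cpoly B) z * S z = poly (D2 - pderiv D1) z"
    if z: "z \<notin> of_real ` \<Delta>" for z
  proof -
    obtain d where d: "d > 0" "\<And>t. t \<in> \<Delta> \<Longrightarrow> d \<le> norm (complex_of_real t - z)"
      using distance_from_support[OF closed z] by blast
    have "set_integrable lborel \<Delta> \<phi>" using int[of 1] by simp
    from has_field_derivative_cauchy_transform[OF this closed z]
    have dS: "(S has_field_derivative deriv S z) (at z)"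
      unfolding S by (simp add: DERIV_imp_deriv)
    have "((\<lambda>z. poly p z * S z + poly D1 z) has_field_derivative
             poly p z * deriv S z + poly (pderiv p) z * S z + poly (pderiv D1) z) (at z)"
      by (intro DERIV_add DERIV_mult' poly_DERIV dS)
    hence "(cauchy_transform \<Delta> (\<lambda>t. poly p (of_real t) * \<phi> t) has_field_derivative
             poly p z * deriv S z + poly (pderiv p) z * S z + poly (pderiv D1) z) (at z)"
      by (rule has_field_derivative_transform_within_open[where S = "- of_real ` \<Delta>"])
         (use z closed_of_real_image[OF closed] D1 in auto)
    with has_field_derivative_cauchy_transform[OF int closed z]
    have square: "(LINT t:\<Delta>|lborel. poly p (of_real t) * \<phi> t / (of_real t - z)\<^sup>2)
        = poly p z * deriv S z + poly (pderiv p) z * S z + poly (pderiv D1) z"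
      by (rule DERIV_unique)
    have "0 = (LINT t:\<Delta>|lborel. poly q (of_real t) * \<phi> t / (of_real t - z) - poly p (of_real t) * \<phi> t / (of_real t - z)\<^sup>2)"
      using integral_weight_by_parts[OF w z[unfolded \<Delta>_def]] unfolding \<Delta>_def \<phi>_def p_def q_def by (rule sym)
    also have "\<dots> = cauchy_transform \<Delta> (\<lambda>t. poly q (of_real t) * \<phi> t) z
         - (LINT t:\<Delta>|lborel. poly p (of_real t) * \<phi> t / (of_real t - z)\<^sup>2)"
      unfolding cauchy_transform_def
      using set_integrable_cauchy_kernel[OF int d, of _ 1] set_integrable_cauchy_kernel[OF int d, of _ 2]
      by (intro set_integral_diff(2)) auto
    finally show ?thesis unfolding square D2[OF z] unfolding p_def q_def by (simp add: algebra_simps)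
  qed
  thus ?thesis unfolding \<Delta>_def by blast
qed

section \<open>Derivatives of functions of the second kind\<close>

text \<open>
  For a weight \<open>w\<close> with \<open>w' / w = b / a\<close> these two functions are \<open>a w (h / w)'\<close> and \<open>a\<^sup>2 w (h / w)''\<close>,
  see \<open>cleared_deriv_weight_branch\<close>. In the form chosen here
  they visibly do not depend on the branch of \<open>w\<close>.
\<close>

definition cleared_deriv :: "complex poly \<Rightarrow> complex poly \<Rightarrow> (complex \<Rightarrow> complex) \<Rightarrow> complex \<Rightarrow> complex" where
  "cleared_deriv a b h z = poly a z * deriv h z - poly b z * h z"

definition cleared_deriv2 :: "complex poly \<Rightarrow> complex poly \<Rightarrow> (complex \<Rightarrow> complex) \<Rightarrow> complex \<Rightarrow> complex" where
  "cleared_deriv2 a b h z =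
     (poly a z)\<^sup>2 * deriv (deriv h) z - 2 * poly a z * poly b z * deriv h z
     + ((poly b z)\<^sup>2 - poly a z * poly (pderiv b) z + poly (pderiv a) z * poly b z) * h z"

lemma deriv_divide_weight_branch:
  assumes w: "weight_branch A B U w" and h: "h holomorphic_on U" and z: "z \<in> U"
  shows "deriv (\<lambda>z. h z / w z) z = (deriv h z - poly (cpoly B) z / poly (cpoly A) z * h z) / w z"
proof -
  obtain g where g: "\<And>z. z \<in> U \<Longrightarrow> (g has_field_derivative (poly (cpoly B) z / poly (cpoly A) z)) (at z)"
    "\<And>z. z \<in> U \<Longrightarrow> w z = exp (g z)" and U: "open U"
    using w unfolding weight_branch_def by blast
  have "((\<lambda>z. exp (g z)) has_field_derivative exp (g z) * (poly (cpoly B) z / poly (cpoly A) z)) (at z)"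
    by (rule DERIV_chain'[OF g(1)[OF z] DERIV_exp])
  hence w': "(w has_field_derivative w z * (poly (cpoly B) z / poly (cpoly A) z)) (at z)"
    unfolding g(2)[OF z] by (rule has_field_derivative_transform_within_open[OF _ U z]) (simp add: g(2))
  have nz: "w z \<noteq> 0" using g(2)[OF z] by simp
  have h': "(h has_field_derivative deriv h z) (at z)" using h U z by (rule holomorphic_derivI)
  have kernel: "(h1 * w - h0 * (w * r)) / (w * w) = (h1 - r * h0) / w" if "w \<noteq> 0" for h0 h1 w r :: complex
    using that by (simp add: divide_simps) (simp add: algebra_simps)
  show ?thesis using DERIV_imp_deriv[OF DERIV_divide[OF h' w' nz]] unfolding kernel[OF nz] .
qed

lemma deriv2_divide_weight_branch:
  assumes w: "weight_branch A B U w" and h: "h holomorphic_on U" and z: "z \<in> U"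
  defines "a \<equiv> cpoly A" and "b \<equiv> cpoly B"
  shows "(poly a z)\<^sup>2 * w z * deriv (deriv (\<lambda>z. h z / w z)) z =
     (poly a z)\<^sup>2 * deriv (deriv h) z - 2 * poly a z * poly b z * deriv h z
       + ((poly b z)\<^sup>2 - poly a z * poly (pderiv b) z + poly (pderiv a) z * poly b z) * h z"
proof -
  have U: "open U" and a: "\<And>z. z \<in> U \<Longrightarrow> poly a z \<noteq> 0"
    using w unfolding weight_branch_def a_def by auto
  have wz: "w z \<noteq> 0" using w z unfolding weight_branch_def by fastforce
  define k where "k = (\<lambda>z. deriv h z - poly b z / poly a z * h z)"
  have dh: "deriv h holomorphic_on U" using h U by (rule holomorphic_deriv)
  have k: "k holomorphic_on U"
    unfolding k_def using h dh a U by (intro holomorphic_intros) auto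
  have "deriv (deriv (\<lambda>z. h z / w z)) z = deriv (\<lambda>z. k z / w z) z"
  proof (rule deriv_cong_ev)
    have "\<forall>\<^sub>F z in nhds z. z \<in> U" using U z by (rule eventually_nhds_in_open)
    thus "\<forall>\<^sub>F z in nhds z. deriv (\<lambda>z. h z / w z) z = k z / w z"
      by eventually_elim (simp add: deriv_divide_weight_branch[OF w h] k_def a_def b_def)
  qed simp
  also have "\<dots> = (deriv k z - poly b z / poly a z * k z) / w z"
    unfolding a_def b_def by (rule deriv_divide_weight_branch[OF w k z])
  finally have eq: "w z * deriv (deriv (\<lambda>z. h z / w z)) z = deriv k z - poly b z / poly a z * k z"
    using wz by simp
  have "(k has_field_derivative deriv (deriv h) z -
      ((poly (pderiv b) z * poly a z - poly b z * poly (pderiv a) z) / (poly a z * poly a z) * h z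
         + deriv h z * (poly b z / poly a z))) (at z)"
    unfolding k_def
    by (intro DERIV_diff DERIV_mult DERIV_divide poly_DERIV holomorphic_derivI[OF dh U z]
        holomorphic_derivI[OF h U z] a[OF z])
  hence dk: "deriv k z = deriv (deriv h) z -
      ((poly (pderiv b) z * poly a z - poly b z * poly (pderiv a) z) / (poly a z * poly a z) * h z
         + deriv h z * (poly b z / poly a z))" by (rule DERIV_imp_deriv)
  have kernel: "a0\<^sup>2 * ((h2 - ((b1 * a0 - b0 * a1) / (a0 * a0) * h0 + h1 * (b0 / a0))) - b0 / a0 * (h1 - b0 / a0 * h0))
     = a0\<^sup>2 * h2 - 2 * a0 * b0 * h1 + (b0\<^sup>2 - a0 * b1 + a1 * b0) * h0"
    if "a0 \<noteq> 0" for a0 a1 b0 b1 h0 h1 h2 :: complex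
    using that by (simp add: divide_simps power2_eq_square) (simp add: algebra_simps)
  show ?thesis
    using eq unfolding dk unfolding k_def by (simp only: kernel[OF a[OF z]] mult.assoc[of "(poly a z)\<^sup>2" "w z"])
qed

lemma cleared_deriv_weight_branch:
  assumes w: "weight_branch A B U w" and h: "h holomorphic_on U" and z: "z \<in> U"
  shows "w z * (h z / w z) = h z"
    and "poly (cpoly A) z * w z * deriv (\<lambda>z. h z / w z) z = cleared_deriv (cpoly A) (cpoly B) h z"
    and "(poly (cpoly A) z)\<^sup>2 * w z * deriv (deriv (\<lambda>z. h z / w z)) z = cleared_deriv2 (cpoly A) (cpoly B) h z"
proof -
  have nz: "poly (cpoly A) z \<noteq> 0" "w z \<noteq> 0" using w z unfolding weight_branch_def by fastforce+
  show "w z * (h z / w z) = h z" using nz by simp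
  show "poly (cpoly A) z * w z * deriv (\<lambda>z. h z / w z) z = cleared_deriv (cpoly A) (cpoly B) h z"
    unfolding deriv_divide_weight_branch[OF assms] cleared_deriv_def using nz
    by (simp add: field_simps)
  show "(poly (cpoly A) z)\<^sup>2 * w z * deriv (deriv (\<lambda>z. h z / w z)) z = cleared_deriv2 (cpoly A) (cpoly B) h z"
    unfolding deriv2_divide_weight_branch[OF assms] cleared_deriv2_def ..
qed

text \<open>
  The second and third entry of the column of \<open>h / w\<close>, with denominators cleared, are a polynomial
  plus \<open>S\<close> times the corresponding entry of the column of \<open>P\<close>. The derivative of \<open>S\<close> disappears
  because \<open>a S' - b S = C\<close>; for the third entry, the second cleared derivative is
  \<open>a H' - (a' + b) H\<close>, where \<open>H\<close> is the first. The polynomial part of the third entry is kept in the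
  form \<open>a K - (a' + b) G\<close>, which exhibits it modulo \<open>a\<close>.
\<close>

lemma cleared_deriv_of_ode:
  fixes P D C a b :: "complex poly"
  assumes V: "open V" and S: "S holomorphic_on V"
    and ode: "\<And>z. z \<in> V \<Longrightarrow> poly a z * deriv S z - poly b z * S z = poly C z"
    and h: "\<And>z. z \<in> V \<Longrightarrow> h z = poly P z * S z + poly D z"
  defines "G \<equiv> P * C + a * pderiv D - b * D"
  defines "K \<equiv> pderiv P * C + pderiv G"
  assumes z: "z \<in> V"
  shows "cleared_deriv a b h z = poly G z + poly a z * poly (pderiv P) z * S z"
    and "cleared_deriv2 a b h z = poly (a * K - (pderiv a + b) * G) z + (poly a z)\<^sup>2 * poly (pderiv (pderiv P)) z * S z"
proof -
  have dS: "(S has_field_derivative deriv S z) (at z)" if "z \<in> V" for z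
    using S V that by (rule holomorphic_derivI)
  have dh: "deriv h z = poly (pderiv P) z * S z + poly P z * deriv S z + poly (pderiv D) z" if z: "z \<in> V" for z
  proof -
    have "((\<lambda>z. poly P z * S z + poly D z) has_field_derivative
            poly P z * deriv S z + poly (pderiv P) z * S z + poly (pderiv D) z) (at z)"
      by (intro DERIV_add DERIV_mult' poly_DERIV dS z)
    hence "(h has_field_derivative
            poly P z * deriv S z + poly (pderiv P) z * S z + poly (pderiv D) z) (at z)"
      by (rule has_field_derivative_transform_within_open[OF _ V z]) (simp add: h)
    thus ?thesis by (simp add: DERIV_imp_deriv add.commute)
  qed
  have first: "cleared_deriv a b h z = poly G z + poly a z * poly (pderiv P) z * S z" if z: "z \<in> V" for z
    unfolding cleared_deriv_def dh[OF z] h[OF z] G_def poly_add poly_diff poly_mult ode[OF z, symmetric]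
    by (simp add: algebra_simps)
  show "cleared_deriv a b h z = poly G z + poly a z * poly (pderiv P) z * S z" by (rule first[OF z])
  have h_hol: "h holomorphic_on V"
  proof -
    have "(\<lambda>z. poly P z * S z + poly D z) holomorphic_on V" using S by (intro holomorphic_intros)
    thus ?thesis using h by (simp add: holomorphic_transform)
  qed
  have h': "(h has_field_derivative deriv h z) (at z)" using h_hol V z by (rule holomorphic_derivI)
  have h'': "(deriv h has_field_derivative deriv (deriv h) z) (at z)"
    using holomorphic_deriv[OF h_hol V] V z by (rule holomorphic_derivI)
  have "((\<lambda>z. poly a z * deriv h z - poly b z * h z) has_field_derivative
      (poly a z * deriv (deriv h) z + poly (pderiv a) z * deriv h z)
      - (poly b z * deriv h z + poly (pderiv b) z * h z)) (at z)"
    by (intro DERIV_diff DERIV_mult' poly_DERIV h' h'')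
  moreover have "((\<lambda>z. poly a z * deriv h z - poly b z * h z) has_field_derivative
      poly (pderiv G) z + (poly a z * poly (pderiv P) z * deriv S z
        + (poly a z * poly (pderiv (pderiv P)) z + poly (pderiv a) z * poly (pderiv P) z) * S z)) (at z)"
  proof -
    have "((\<lambda>z. poly G z + poly a z * poly (pderiv P) z * S z) has_field_derivative
      poly (pderiv G) z + (poly a z * poly (pderiv P) z * deriv S z
        + (poly a z * poly (pderiv (pderiv P)) z + poly (pderiv a) z * poly (pderiv P) z) * S z)) (at z)"
      by (intro DERIV_add DERIV_mult' poly_DERIV dS z)
    thus ?thesis
      by (rule has_field_derivative_transform_within_open[OF _ V z])
         (use first in \<open>simp add: cleared_deriv_def\<close>)
  qed
  ultimately have second:
    "(poly a z * deriv (deriv h) z + poly (pderiv a) z * deriv h z)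
      - (poly b z * deriv h z + poly (pderiv b) z * h z)
     = poly (pderiv G) z + (poly a z * poly (pderiv P) z * deriv S z
        + (poly a z * poly (pderiv (pderiv P)) z + poly (pderiv a) z * poly (pderiv P) z) * S z)"
    by (rule DERIV_unique)
  have "cleared_deriv2 a b h z
      = poly a z * ((poly a z * deriv (deriv h) z + poly (pderiv a) z * deriv h z)
          - (poly b z * deriv h z + poly (pderiv b) z * h z))
        - (poly (pderiv a) z + poly b z) * cleared_deriv a b h z"
    by (simp add: cleared_deriv2_def cleared_deriv_def power2_eq_square algebra_simps)
  also have "\<dots> = poly (a * K - (pderiv a + b) * G) z + (poly a z)\<^sup>2 * poly (pderiv (pderiv P)) z * S z"
    unfolding second first[OF z] K_def poly_add poly_diff poly_mult ode[OF z, symmetric]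
    by (simp add: power2_eq_square algebra_simps)
  finally show "cleared_deriv2 a b h z
     = poly (a * K - (pderiv a + b) * G) z + (poly a z)\<^sup>2 * poly (pderiv (pderiv P)) z * S z" .
qed

text \<open>
  The numerator of the function of the second kind.
\<close>

definition weighted_transform :: "complex poly \<Rightarrow> real set \<Rightarrow> (real \<Rightarrow> real) \<Rightarrow> complex \<Rightarrow> complex" where
  "weighted_transform P \<Delta> \<omega> = cauchy_transform \<Delta> (\<lambda>t. poly P (of_real t) * of_real (\<omega> t))"

lemma second_kind_eq: "second_kind P \<Delta> \<omega> w = (\<lambda>z. weighted_transform P \<Delta> \<omega> z / w z)"
  by (simp add: fun_eq_iff second_kind_def weighted_transform_def cauchy_transform_def)

lemma closed_semiclassical_support:
  "semiclassical_weight A B E \<omega> \<Longrightarrow> closed (support_of E)"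
  by (auto simp: semiclassical_weight_def admissible_intervals_def intro: closed_support_of)

lemma weighted_transform_structure:
  fixes P :: "complex poly"
  assumes w: "semiclassical_weight A B E \<omega>"
  defines "a \<equiv> cpoly A" and "b \<equiv> cpoly B" and "h \<equiv> weighted_transform P (support_of E) \<omega>"
  obtains S and D G K :: "complex poly" where
    "\<And>z. z \<notin> of_real ` support_of E \<Longrightarrow> h z = poly D z + poly P z * S z"
    "\<And>z. z \<notin> of_real ` support_of E \<Longrightarrow> cleared_deriv a b h z = poly G z + poly a z * poly (pderiv P) z * S z"
    "\<And>z. z \<notin> of_real ` support_of E \<Longrightarrow>
        cleared_deriv2 a b h z = poly (a * K - (pderiv a + b) * G) z + (poly a z)\<^sup>2 * poly (pderiv (pderiv P)) z * S z"
proof -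
  define \<phi> where "\<phi> = (\<lambda>t. complex_of_real (\<omega> t))"
  define S where "S = cauchy_transform (support_of E) \<phi>"
  note closed = closed_semiclassical_support[OF w]
  have int: "set_integrable lborel (support_of E) (\<lambda>t. poly p (of_real t) * \<phi> t)" for p
    unfolding \<phi>_def by (rule semiclassical_integrable[OF w])
  have open_V: "open (- complex_of_real ` support_of E)" using closed_of_real_image[OF closed] by (rule open_Compl)
  have S_hol: "S holomorphic_on - of_real ` support_of E"
    unfolding S_def using int[of 1] closed by (intro cauchy_transform_holomorphic) auto
  obtain C where C: "\<And>z. z \<notin> of_real ` support_of E \<Longrightarrow> poly a z * deriv S z - poly b z * S z = poly C z"
    using stieltjes_ode[OF w] unfolding a_def b_def S_def \<phi>_def by blast
  obtain D where D: "\<And>z. z \<notin> of_real ` support_of E \<Longrightarrow> h z = poly P z * S z + poly D z"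
    using cauchy_transform_poly_times[OF int closed, of P]
    unfolding S_def h_def \<phi>_def weighted_transform_def by blast
  show ?thesis
    by (rule that[OF _ cleared_deriv_of_ode(1)[OF open_V S_hol _ D] cleared_deriv_of_ode(2)[OF open_V S_hol _ D]])
       (use C D in auto)
qed

lemma weighted_transform_holomorphic:
  assumes "semiclassical_weight A B E \<omega>"
  shows "weighted_transform P (support_of E) \<omega> holomorphic_on - of_real ` support_of E"
  unfolding weighted_transform_def
  by (rule cauchy_transform_holomorphic[OF semiclassical_integrable[OF assms] closed_semiclassical_support[OF assms]])

section \<open>The Wronskian with cleared denominators\<close>

lemma det_3:
  fixes f :: "nat \<times> nat \<Rightarrow> 'a :: comm_ring_1"
  shows "Determinant.det (Matrix.mat 3 3 f) =
     f (0,0) * (f (1,1) * f (2,2) - f (1,2) * f (2,1))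
   - f (1,0) * (f (0,1) * f (2,2) - f (0,2) * f (2,1))
   + f (2,0) * (f (0,1) * f (1,2) - f (0,2) * f (1,1))"
proof -
  have det_2: "Determinant.det (Matrix.mat 2 2 g) = g (0,0) * g (1,1) - g (0,1) * g (1,0)"
    for g :: "nat \<times> nat \<Rightarrow> 'a"
  proof -
    have "Determinant.det (Matrix.mat 2 2 g) = (\<Sum>i<2. Matrix.mat 2 2 g $$ (i,0) * cofactor (Matrix.mat 2 2 g) i 0)"
      by (rule laplace_expansion_column) auto
    also have "\<dots> = g (0,0) * g (1,1) - g (0,1) * g (1,0)"
      by (simp add: numeral_2_eq_2 cofactor_def mat_delete_def det_single mult.commute)
    finally show ?thesis .
  qed
  have "Determinant.det (Matrix.mat 3 3 f) = (\<Sum>i<3. Matrix.mat 3 3 f $$ (i,0) * cofactor (Matrix.mat 3 3 f) i 0)"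
    by (rule laplace_expansion_column) auto
  also have "\<dots> = f (0,0) * (f (1,1) * f (2,2) - f (1,2) * f (2,1))
   - f (1,0) * (f (0,1) * f (2,2) - f (0,2) * f (2,1))
   + f (2,0) * (f (0,1) * f (1,2) - f (0,2) * f (1,1))"
    by (simp add: eval_nat_numeral cofactor_def mat_delete_def det_2[unfolded numeral_2_eq_2] algebra_simps)
  finally show ?thesis .
qed

lemma Wrons_3:
  "Wrons [f, g, h] z =
      f z * (deriv g z * deriv (deriv h) z - deriv h z * deriv (deriv g) z)
    - deriv f z * (g z * deriv (deriv h) z - h z * deriv (deriv g) z)
    + deriv (deriv f) z * (g z * deriv h z - h z * deriv g z)"
proof -
  have "length [f, g, h] = 3" by simp
  thus ?thesis unfolding Wrons_def by (simp only: det_3) (simp add: numeral_2_eq_2)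
qed

text \<open>
  This is \<open>a\<^sub>1\<^sup>2 a\<^sub>2\<^sup>2\<close> times the determinant with columns \<open>(p, p', p'')\<close>,
  \<open>(u\<^sub>1, u\<^sub>1' / a\<^sub>1, u\<^sub>1'' / a\<^sub>1\<^sup>2)\<close> and \<open>(u\<^sub>2, u\<^sub>2' / a\<^sub>2, u\<^sub>2'' / a\<^sub>2\<^sup>2)\<close>, expanded along the first column and
  free of divisions. It is stated for commutative rings so that it applies to polynomials as well as
  to their values; the primes are part of the variable names.
\<close>

definition cleared_wronskian :: "'a::comm_ring_1 \<Rightarrow> 'a \<Rightarrow> 'a \<Rightarrow> 'a \<Rightarrow> 'a \<Rightarrow> 'a \<Rightarrow> 'a \<Rightarrow> 'a \<Rightarrow> 'a \<Rightarrow> 'a \<Rightarrow> 'a \<Rightarrow> 'a"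
  where "cleared_wronskian p p' p'' a\<^sub>1 u\<^sub>1 u\<^sub>1' u\<^sub>1'' a\<^sub>2 u\<^sub>2 u\<^sub>2' u\<^sub>2'' =
     p * (a\<^sub>1 * u\<^sub>1' * u\<^sub>2'' - a\<^sub>2 * u\<^sub>2' * u\<^sub>1'')
     - p' * (a\<^sub>1\<^sup>2 * u\<^sub>1 * u\<^sub>2'' - a\<^sub>2\<^sup>2 * u\<^sub>2 * u\<^sub>1'')
     + p'' * (a\<^sub>1\<^sup>2 * a\<^sub>2 * u\<^sub>1 * u\<^sub>2' - a\<^sub>1 * a\<^sub>2\<^sup>2 * u\<^sub>2 * u\<^sub>1')"

lemma poly_cleared_wronskian:
  "poly (cleared_wronskian p p' p'' a u u' u'' b v v' v'') z =
   cleared_wronskian (poly p z) (poly p' z) (poly p'' z) (poly a z) (poly u z) (poly u' z) (poly u'' z)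
     (poly b z) (poly v z) (poly v' z) (poly v'' z)"
  by (simp add: cleared_wronskian_def)

lemma cleared_wronskian_column_operation:
  "cleared_wronskian p p' p'' a (u + p * s) (u' + a * p' * s) (u'' + a\<^sup>2 * p'' * s)
      b (v + p * t) (v' + b * p' * t) (v'' + b\<^sup>2 * p'' * t)
   = cleared_wronskian p p' p'' a u u' u'' b v v' v''"
  by (simp add: cleared_wronskian_def power2_eq_square algebra_simps)

lemma cleared_wronskian_eq:
  assumes "w\<^sub>1 * q\<^sub>1 = u\<^sub>1" "a\<^sub>1 * w\<^sub>1 * q\<^sub>1' = u\<^sub>1'" "a\<^sub>1\<^sup>2 * w\<^sub>1 * q\<^sub>1'' = u\<^sub>1''"
    and "w\<^sub>2 * q\<^sub>2 = u\<^sub>2" "a\<^sub>2 * w\<^sub>2 * q\<^sub>2' = u\<^sub>2'" "a\<^sub>2\<^sup>2 * w\<^sub>2 * q\<^sub>2'' = u\<^sub>2''"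
  shows "cleared_wronskian p p' p'' a\<^sub>1 u\<^sub>1 u\<^sub>1' u\<^sub>1'' a\<^sub>2 u\<^sub>2 u\<^sub>2' u\<^sub>2'' =
     a\<^sub>1\<^sup>2 * a\<^sub>2\<^sup>2 * w\<^sub>1 * w\<^sub>2 *
       (p * (q\<^sub>1' * q\<^sub>2'' - q\<^sub>2' * q\<^sub>1'') - p' * (q\<^sub>1 * q\<^sub>2'' - q\<^sub>2 * q\<^sub>1'') + p'' * (q\<^sub>1 * q\<^sub>2' - q\<^sub>2 * q\<^sub>1'))"
  unfolding assms[symmetric] cleared_wronskian_def by (simp add: power2_eq_square algebra_simps)

section \<open>Order of growth along the imaginary axis\<close>

text \<open>
  Growth is only measured on the positive imaginary axis: the transforms are holomorphic there
  whatever the support, and a ray is enough to determine the degree of a polynomial. Negative orders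
  occur, hence the integer exponent.
\<close>

definition growth_le :: "(complex \<Rightarrow> complex) \<Rightarrow> int \<Rightarrow> bool" where
  "growth_le f k \<longleftrightarrow> (\<exists>C. \<forall>y\<ge>1. norm (f (\<i> * of_real y)) \<le> C * y powi k)"

lemma growth_leI: "(\<And>y. y \<ge> 1 \<Longrightarrow> norm (f (\<i> * of_real y)) \<le> C * y powi k) \<Longrightarrow> growth_le f k"
  unfolding growth_le_def by blast

lemma growth_leE:
  assumes "growth_le f k"
  obtains C where "C \<ge> 0" "\<And>y. y \<ge> 1 \<Longrightarrow> norm (f (\<i> * of_real y)) \<le> C * y powi k"
proof -
  obtain C where C: "\<And>y. y \<ge> 1 \<Longrightarrow> norm (f (\<i> * of_real y)) \<le> C * y powi k"
    using assms unfolding growth_le_def by blast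
  have "0 \<le> norm (f (\<i> * of_real 1))" by simp
  also have "\<dots> \<le> C" using C[of 1] by simp
  finally show ?thesis using C that by blast
qed

lemma growth_le_mono:
  assumes "growth_le f k" "k \<le> l" shows "growth_le f l"
proof -
  obtain C where C: "C \<ge> 0" "\<And>y. y \<ge> 1 \<Longrightarrow> norm (f (\<i> * of_real y)) \<le> C * y powi k"
    using growth_leE[OF assms(1)] by blast
  show ?thesis
  proof (rule growth_leI)
    fix y :: real assume y: "y \<ge> 1"
    have "C * y powi k \<le> C * y powi l"
      using y C(1) assms(2) by (intro mult_left_mono power_int_increasing) auto
    thus "norm (f (\<i> * of_real y)) \<le> C * y powi l" using C(2)[OF y] by linarith
  qed
qed

lemma growth_le_add:
  assumes "growth_le f k" "growth_le g k" shows "growth_le (\<lambda>z. f z + g z) k"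
proof -
  obtain C where C: "\<And>y. y \<ge> 1 \<Longrightarrow> norm (f (\<i> * of_real y)) \<le> C * y powi k"
    using growth_leE[OF assms(1)] by blast
  obtain D where D: "\<And>y. y \<ge> 1 \<Longrightarrow> norm (g (\<i> * of_real y)) \<le> D * y powi k"
    using growth_leE[OF assms(2)] by blast
  show ?thesis
  proof (rule growth_leI)
    fix y :: real assume y: "y \<ge> 1"
    show "norm (f (\<i> * of_real y) + g (\<i> * of_real y)) \<le> (C + D) * y powi k"
      using norm_triangle_le[OF add_mono[OF C[OF y] D[OF y]]] by (simp add: distrib_right)
  qed
qed

lemma growth_le_minus: "growth_le f k \<Longrightarrow> growth_le (\<lambda>z. - f z) k"
  by (simp add: growth_le_def)

lemma growth_le_diff:
  assumes "growth_le f k" "growth_le g k" shows "growth_le (\<lambda>z. f z - g z) k"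
  using growth_le_add[OF assms(1) growth_le_minus[OF assms(2)]] by simp

lemma growth_le_mult:
  assumes "growth_le f k" "growth_le g l" "k + l \<le> m" shows "growth_le (\<lambda>z. f z * g z) m"
proof (rule growth_le_mono[OF _ assms(3)])
  obtain C where C: "C \<ge> 0" "\<And>y. y \<ge> 1 \<Longrightarrow> norm (f (\<i> * of_real y)) \<le> C * y powi k"
    using growth_leE[OF assms(1)] by blast
  obtain D where D: "\<And>y. y \<ge> 1 \<Longrightarrow> norm (g (\<i> * of_real y)) \<le> D * y powi l"
    using growth_leE[OF assms(2)] by blast
  show "growth_le (\<lambda>z. f z * g z) (k + l)"
  proof (rule growth_leI)
    fix y :: real assume y: "y \<ge> 1"
    have "norm (f (\<i> * of_real y)) * norm (g (\<i> * of_real y)) \<le> (C * y powi k) * (D * y powi l)"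
      using C D y by (intro mult_mono) auto
    also have "\<dots> = C * D * y powi (k + l)" using y by (simp add: power_int_add mult_ac)
    finally show "norm (f (\<i> * of_real y) * g (\<i> * of_real y)) \<le> C * D * y powi (k + l)"
      by (simp add: norm_mult)
  qed
qed

text \<open>
  The bound is on the indices of non-zero coefficients, not on the degree, since \<open>k\<close> may be
  negative: the zero polynomial, which may arise as a derivative of \<open>P\<close>, satisfies it for all \<open>k\<close>.
\<close>

lemma growth_le_poly:
  assumes "\<And>j. coeff p j \<noteq> 0 \<Longrightarrow> int j \<le> k"
  shows "growth_le (poly p) k"
proof (rule growth_leI)
  fix y :: real assume y: "y \<ge> 1"
  have "norm (poly p (\<i> * of_real y)) \<le> (\<Sum>j\<le>degree p. norm (coeff p j * (\<i> * of_real y) ^ j))"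
    unfolding poly_altdef by (rule norm_sum)
  also have "\<dots> \<le> (\<Sum>j\<le>degree p. norm (coeff p j) * y powi k)"
  proof (rule sum_mono)
    fix j
    show "norm (coeff p j * (\<i> * of_real y) ^ j) \<le> norm (coeff p j) * y powi k"
    proof (cases "coeff p j = 0")
      case False
      have "y ^ j \<le> y powi k"
        using power_int_increasing[OF assms[OF False], of y] y by simp
      thus ?thesis using y by (simp add: norm_mult norm_power mult_left_mono)
    qed simp
  qed
  also have "\<dots> = (\<Sum>j\<le>degree p. norm (coeff p j)) * y powi k" by (simp add: sum_distrib_right)
  finally show "norm (poly p (\<i> * of_real y)) \<le> (\<Sum>j\<le>degree p. norm (coeff p j)) * y powi k" .
qed

text \<open>
  Induction on \<open>k\<close>, removing the constant coefficient and dividing by \<open>z\<close>; for \<open>k = 0\<close>, a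
  non-constant polynomial is unbounded on every ray.
\<close>

lemma degree_le_of_growth_le:
  assumes "growth_le (poly p) (int k)"
  shows "degree p \<le> k"
  using assms
proof (induction k arbitrary: p)
  case 0
  then obtain C where C: "\<And>y. y \<ge> 1 \<Longrightarrow> norm (poly p (\<i> * of_real y)) \<le> C"
    unfolding growth_le_def by auto
  obtain a p' where p: "p = pCons a p'" by (cases p)
  have "p' = 0"
  proof (rule ccontr)
    assume "p' \<noteq> 0"
    from poly_infinity[OF this, of "C + 1" a] obtain r where r: "\<And>z. r \<le> norm z \<Longrightarrow> C + 1 \<le> norm (poly p z)"
      unfolding p by blast
    have "C + 1 \<le> norm (poly p (\<i> * of_real (max 1 r)))" by (rule r) (simp add: norm_mult)
    also have "\<dots> \<le> C" by (rule C) simp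
    finally show False by simp
  qed
  thus ?case using p by simp
next
  case (Suc k)
  obtain a p' where p: "p = pCons a p'" by (cases p)
  obtain C where C: "C \<ge> 0" "\<And>y. y \<ge> 1 \<Longrightarrow> norm (poly p (\<i> * of_real y)) \<le> C * y powi int (Suc k)"
    using growth_leE[OF Suc.prems] by blast
  have "growth_le (poly p') (int k)"
  proof (rule growth_leI)
    fix y :: real assume y: "y \<ge> 1"
    have "y * norm (poly p' (\<i> * of_real y)) = norm (poly p (\<i> * of_real y) - a)"
      using y by (simp add: p norm_mult)
    also have "\<dots> \<le> norm (poly p (\<i> * of_real y)) + norm a" by (rule norm_triangle_ineq4)
    also have "\<dots> \<le> C * y ^ Suc k + norm a * y ^ Suc k"
    proof (rule add_mono)
      show "norm (poly p (\<i> * of_real y)) \<le> C * y ^ Suc k" using C(2)[OF y] by (simp only: power_int_of_nat)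
      show "norm a \<le> norm a * y ^ Suc k"
        using mult_left_mono[OF one_le_power[OF y, of "Suc k"], of "norm a"] by simp
    qed
    also have "\<dots> = y * ((C + norm a) * y ^ k)" by (simp add: algebra_simps)
    finally show "norm (poly p' (\<i> * of_real y)) \<le> (C + norm a) * y powi int k" using y by simp
  qed
  hence "degree p' \<le> k" by (rule Suc.IH)
  thus ?case unfolding p by (metis Suc_le_mono degree_pCons_le order_trans)
qed

lemma growth_le_weighted_transform:
  assumes w: "semiclassical_weight A B E \<omega>" and orth: "multiple_orthogonal P n (support_of E) \<omega>"
  shows "growth_le ((deriv ^^ j) (weighted_transform P (support_of E) \<omega>)) (- int n - 1 - int j)"
proof -
  define \<phi> where "\<phi> = (\<lambda>t. poly P (complex_of_real t) * complex_of_real (\<omega> t))"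
  have int: "set_integrable lborel (support_of E) (\<lambda>t. of_real t ^ k * \<phi> t)" for k
    using semiclassical_integrable[OF w, of "monom 1 k * P"]
    by (simp add: \<phi>_def poly_monom mult.assoc)
  have zero: "(LINT t:support_of E|lborel. of_real t ^ j * \<phi> t) = 0" if "j < n" for j
    using orth that by (simp add: multiple_orthogonal_def \<phi>_def mult.assoc)
  obtain M where M: "\<And>y j. y > 0 \<Longrightarrow>
      norm ((deriv ^^ j) (cauchy_transform (support_of E) \<phi>) (\<i> * of_real y)) \<le> fact j * M * (2 / y) ^ (n + 1 + j)"
    using cauchy_transform_decay[OF int closed_semiclassical_support[OF w] zero] by blast
  show ?thesis
  proof (rule growth_leI)
    fix y :: real assume y: "y \<ge> 1"
    have exponent: "- int n - 1 - int j = - int (n + 1 + j)" by simp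
    have "(2 / y) ^ (n + 1 + j) = 2 ^ (n + 1 + j) * y powi (- int n - 1 - int j)"
      unfolding exponent power_int_minus power_int_of_nat by (simp add: power_divide divide_inverse power_inverse)
    thus "norm ((deriv ^^ j) (weighted_transform P (support_of E) \<omega>) (\<i> * of_real y))
        \<le> fact j * M * 2 ^ (n + 1 + j) * y powi (- int n - 1 - int j)"
      using M[of y j] y by (simp add: weighted_transform_def \<phi>_def mult.assoc)
  qed
qed

lemma growth_le_cpoly:
  assumes "semiclassical_weight A B E \<omega>"
  defines "\<sigma> \<equiv> class_index A B"
  shows "growth_le (poly (cpoly A)) (\<sigma> + 2)" "growth_le (poly (cpoly B)) (\<sigma> + 1)"
    "growth_le (poly (pderiv (cpoly A))) (\<sigma> + 1)" "growth_le (poly (pderiv (cpoly B))) \<sigma>"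
proof -
  have A: "int j \<le> \<sigma> + 2" if "coeff (cpoly A) j \<noteq> 0" for j
    using le_degree[of A j] that by (auto simp: coeff_map_poly \<sigma>_def class_index_def)
  have B: "int j \<le> \<sigma> + 1" if "coeff (cpoly B) j \<noteq> 0" for j
    using le_degree[of B j] that by (auto simp: coeff_map_poly \<sigma>_def class_index_def)
  show "growth_le (poly (cpoly A)) (\<sigma> + 2)" "growth_le (poly (cpoly B)) (\<sigma> + 1)"
    using A B by (auto intro!: growth_le_poly)
  show "growth_le (poly (pderiv (cpoly A))) (\<sigma> + 1)" "growth_le (poly (pderiv (cpoly B))) \<sigma>"
    using A[of "Suc _"] B[of "Suc _"] by (fastforce intro!: growth_le_poly simp: coeff_pderiv)+
qed

lemma growth_le_entries:
  assumes w: "semiclassical_weight A B E \<omega>" and orth: "multiple_orthogonal P n (support_of E) \<omega>"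
  defines "\<sigma> \<equiv> class_index A B" and "a \<equiv> cpoly A" and "b \<equiv> cpoly B"
    and "h \<equiv> weighted_transform P (support_of E) \<omega>"
  shows "growth_le h (- int n - 1)"
    and "growth_le (cleared_deriv a b h) (\<sigma> - int n)"
    and "growth_le (cleared_deriv2 a b h) (2 * \<sigma> + 1 - int n)"
proof -
  have h: "growth_le h (- int n - 1)" "growth_le (deriv h) (- 2 - int n)" "growth_le (deriv (deriv h)) (- 3 - int n)"
    using growth_le_weighted_transform[OF w orth, of 0] growth_le_weighted_transform[OF w orth, of 1]
      growth_le_weighted_transform[OF w orth, of 2]
    by (simp_all add: h_def numeral_2_eq_2)
  note p = growth_le_cpoly[OF w, folded \<sigma>_def a_def b_def]
  show "growth_le h (- int n - 1)" by (rule h)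
  have "growth_le (\<lambda>z. poly a z * deriv h z - poly b z * h z) (\<sigma> - int n)"
    by (rule growth_le_diff; rule growth_le_mult; (rule p h)?; simp)
  thus "growth_le (cleared_deriv a b h) (\<sigma> - int n)" by (simp add: cleared_deriv_def[abs_def])
  have c: "growth_le (\<lambda>z. (poly a z * poly a z) * deriv (deriv h) z) (2 * \<sigma> + 1 - int n)"
    by (rule growth_le_mult[OF growth_le_mult[OF p(1) p(1) order_refl] h(3)]) simp
  have d: "growth_le (\<lambda>z. (poly a z * poly b z) * deriv h z) (2 * \<sigma> + 1 - int n)"
    by (rule growth_le_mult[OF growth_le_mult[OF p(1) p(2) order_refl] h(2)]) simp
  have e: "growth_le (\<lambda>z. poly b z * poly b z - poly a z * poly (pderiv b) z + poly (pderiv a) z * poly b z) (2 * \<sigma> + 2)"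
    by (intro growth_le_add growth_le_diff growth_le_mult[OF p(2) p(2)] growth_le_mult[OF p(1) p(4)]
        growth_le_mult[OF p(3) p(2)]) simp_all
  have f: "growth_le (\<lambda>z. (poly b z * poly b z - poly a z * poly (pderiv b) z + poly (pderiv a) z * poly b z) * h z) (2 * \<sigma> + 1 - int n)"
    by (rule growth_le_mult[OF e h(1)]) simp
  have "cleared_deriv2 a b h = (\<lambda>z. (poly a z * poly a z) * deriv (deriv h) z - (poly a z * poly b z) * deriv h z
      - (poly a z * poly b z) * deriv h z
      + (poly b z * poly b z - poly a z * poly (pderiv b) z + poly (pderiv a) z * poly b z) * h z)"
    by (auto simp: fun_eq_iff cleared_deriv2_def power2_eq_square algebra_simps)
  thus "growth_le (cleared_deriv2 a b h) (2 * \<sigma> + 1 - int n)"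
    by (simp only:) (intro growth_le_add growth_le_diff c d f)
qed

text \<open>
  Each derivative lowers the order of the entries of the first column by one, and raises that of
  the cleared entries of a transform by \<open>s + 1\<close>; the latter is one less than the order \<open>s + 2\<close> of the
  factor \<open>a\<close> by which the entry has been multiplied. So all six products have the same order.
\<close>

lemma growth_le_cleared_wronskian:
  assumes p: "growth_le p N" "growth_le p' (N - 1)" "growth_le p'' (N - 2)"
    and a: "growth_le a (s + 2)" and u: "growth_le u (- m - 1)" "growth_le u' (s - m)" "growth_le u'' (2 * s + 1 - m)"
    and b: "growth_le b (t + 2)" and v: "growth_le v (- n - 1)" "growth_le v' (t - n)" "growth_le v'' (2 * t + 1 - n)"
    and N: "N = m + n"
  shows "growth_le (\<lambda>z. cleared_wronskian (p z) (p' z) (p'' z) (a z) (u z) (u' z) (u'' z) (b z) (v z) (v' z) (v'' z))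
     (2 * s + 2 * t + 3)"
proof -
  note gm = growth_le_mult[OF _ _ order_refl]
  have 1: "growth_le (\<lambda>z. a z * u' z * v'' z - b z * v' z * u'' z) (2 * s + 2 * t + 3 - N)"
    by (intro growth_le_diff growth_le_mult[OF gm[OF a u(2)] v(3)] growth_le_mult[OF gm[OF b v(2)] u(3)]) (simp_all add: N)
  have 2: "growth_le (\<lambda>z. a z * a z * u z * v'' z - b z * b z * v z * u'' z) (2 * s + 2 * t + 4 - N)"
    by (intro growth_le_diff growth_le_mult[OF gm[OF gm[OF a a] u(1)] v(3)]
        growth_le_mult[OF gm[OF gm[OF b b] v(1)] u(3)]) (simp_all add: N)
  have 3: "growth_le (\<lambda>z. a z * a z * b z * u z * v' z - a z * (b z * b z) * v z * u' z) (2 * s + 2 * t + 5 - N)"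
    by (intro growth_le_diff growth_le_mult[OF gm[OF gm[OF gm[OF a a] b] u(1)] v(2)]
        growth_le_mult[OF gm[OF gm[OF a gm[OF b b]] v(1)] u(2)]) (simp_all add: N)
  show ?thesis unfolding cleared_wronskian_def power2_eq_square
    by (intro growth_le_add growth_le_diff growth_le_mult[OF p(1) 1] growth_le_mult[OF p(2) 2]
        growth_le_mult[OF p(3) 3]) simp_all
qed

section \<open>The Wronskian is a polynomial\<close>

theorem proposition5p5:
  fixes A1 A2 B1 B2 :: "real poly"
    and E1 E2 :: "(ereal \<times> ereal) set"
    and \<omega>1 \<omega>2 :: "real \<Rightarrow> real"
    and n1 n2 :: nat
    and P :: "complex poly"
  defines "\<Delta>1 \<equiv> support_of E1" and "\<Delta>2 \<equiv> support_of E2"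
  defines "q1 \<equiv> second_kind P \<Delta>1 \<omega>1" and "q2 \<equiv> second_kind P \<Delta>2 \<omega>2"
  assumes "semiclassical_weight A1 B1 E1 \<omega>1"
    and "semiclassical_weight A2 B2 E2 \<omega>2"
    and "lead_coeff P = 1" and "degree P = n1 + n2"
    and "multiple_orthogonal P n1 \<Delta>1 \<omega>1"
    and "multiple_orthogonal P n2 \<Delta>2 \<omega>2"
    and "\<exists>U w1 w2. weight_branch A1 B1 U w1 \<and> weight_branch A2 B2 U w2 \<and>
           U \<inter> of_real ` (\<Delta>1 \<union> \<Delta>2) = {} \<and>
           (\<exists>z\<in>U. Wrons [poly P, q1 w1, q2 w2] z \<noteq> 0)"
  shows "\<exists>R :: complex poly.
      (\<forall>U w1 w2. weight_branch A1 B1 U w1 \<and> weight_branch A2 B2 U w2 \<and>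
         U \<inter> of_real ` (\<Delta>1 \<union> \<Delta>2) = {} \<longrightarrow>
         (\<forall>z\<in>U.
            poly R z = poly (cpoly A2) z * v_fun A2 w2 z * L_op A1 w1 P (q1 w1) (q2 w2) z \<and>
            poly R z = - (poly (cpoly A1) z * v_fun A1 w1 z * L_op A2 w2 P (q2 w2) (q1 w1) z) \<and>
            poly R z = poly (cpoly A1) z * poly (cpoly A2) z * v_fun A1 w1 z * v_fun A2 w2 z *
                         Wrons [poly P, q1 w1, q2 w2] z)) \<and>
      int (degree R) \<le> 2 * class_index A1 B1 + 2 * class_index A2 B2 + 3 \<and>
      (A1 = A2 \<longrightarrow> cpoly A1 dvd R) \<and>
      (A1 = A2 \<and> B1 = B2 \<longrightarrow>
         (cpoly A1)\<^sup>2 dvd R \<and>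
         (\<forall>U w. weight_branch A1 B1 U w \<and> U \<inter> of_real ` (\<Delta>1 \<union> \<Delta>2) = {} \<longrightarrow>
            (\<forall>z\<in>U. poly (R div (cpoly A1)\<^sup>2) z =
                     (v_fun A1 w z)\<^sup>2 * Wrons [poly P, q1 w, q2 w] z)))"
proof -
  note w1 = \<open>semiclassical_weight A1 B1 E1 \<omega>1\<close> and w2 = \<open>semiclassical_weight A2 B2 E2 \<omega>2\<close>
  note orth1 = \<open>multiple_orthogonal P n1 \<Delta>1 \<omega>1\<close>[unfolded \<Delta>1_def]
  note orth2 = \<open>multiple_orthogonal P n2 \<Delta>2 \<omega>2\<close>[unfolded \<Delta>2_def]
  define a1 b1 a2 b2 where "a1 = cpoly A1" and "b1 = cpoly B1" and "a2 = cpoly A2" and "b2 = cpoly B2"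
  note poly_defs = a1_def b1_def a2_def b2_def
  define h1 h2 where "h1 = weighted_transform P \<Delta>1 \<omega>1" and "h2 = weighted_transform P \<Delta>2 \<omega>2"
  have q: "q1 w = (\<lambda>z. h1 z / w z)" "q2 w = (\<lambda>z. h2 z / w z)" for w
    by (simp_all add: q1_def q2_def h1_def h2_def second_kind_eq)
  obtain S1 D1 G1 K1 where s1:
    "\<And>z. z \<notin> of_real ` \<Delta>1 \<Longrightarrow> h1 z = poly D1 z + poly P z * S1 z"
    "\<And>z. z \<notin> of_real ` \<Delta>1 \<Longrightarrow> cleared_deriv a1 b1 h1 z = poly G1 z + poly a1 z * poly (pderiv P) z * S1 z"
    "\<And>z. z \<notin> of_real ` \<Delta>1 \<Longrightarrow>
        cleared_deriv2 a1 b1 h1 z = poly (a1 * K1 - (pderiv a1 + b1) * G1) z + (poly a1 z)\<^sup>2 * poly (pderiv (pderiv P)) z * S1 z"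
    using weighted_transform_structure[OF w1, of P] unfolding \<Delta>1_def h1_def poly_defs by metis
  obtain S2 D2 G2 K2 where s2:
    "\<And>z. z \<notin> of_real ` \<Delta>2 \<Longrightarrow> h2 z = poly D2 z + poly P z * S2 z"
    "\<And>z. z \<notin> of_real ` \<Delta>2 \<Longrightarrow> cleared_deriv a2 b2 h2 z = poly G2 z + poly a2 z * poly (pderiv P) z * S2 z"
    "\<And>z. z \<notin> of_real ` \<Delta>2 \<Longrightarrow>
        cleared_deriv2 a2 b2 h2 z = poly (a2 * K2 - (pderiv a2 + b2) * G2) z + (poly a2 z)\<^sup>2 * poly (pderiv (pderiv P)) z * S2 z"
    using weighted_transform_structure[OF w2, of P] unfolding \<Delta>2_def h2_def poly_defs by metis
  define X1 X2 where "X1 = a1 * K1 - (pderiv a1 + b1) * G1" and "X2 = a2 * K2 - (pderiv a2 + b2) * G2"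
  define R where "R = cleared_wronskian P (pderiv P) (pderiv (pderiv P)) a1 D1 G1 X1 a2 D2 G2 X2"

  \<comment> \<open>the columns built from \<open>h\<close> and from \<open>D\<close>, \<open>G\<close>, \<open>X\<close> differ by \<open>S\<close> times the column of \<open>P\<close>\<close>
  have R_eq: "poly R z = cleared_wronskian (poly P z) (poly (pderiv P) z) (poly (pderiv (pderiv P)) z)
      (poly a1 z) (h1 z) (cleared_deriv a1 b1 h1 z) (cleared_deriv2 a1 b1 h1 z)
      (poly a2 z) (h2 z) (cleared_deriv a2 b2 h2 z) (cleared_deriv2 a2 b2 h2 z)"
    if "z \<notin> of_real ` (\<Delta>1 \<union> \<Delta>2)" for z
  proof -
    have z: "z \<notin> of_real ` \<Delta>1" "z \<notin> of_real ` \<Delta>2" using that by auto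
    show ?thesis
      unfolding R_def poly_cleared_wronskian s1[OF z(1)] s2[OF z(2)] cleared_wronskian_column_operation
      by (simp only: X1_def X2_def)
  qed

  have wronskian: "poly R z = (poly a1 z)\<^sup>2 * (poly a2 z)\<^sup>2 * u1 z * u2 z * Wrons [poly P, q1 u1, q2 u2] z"
    if br: "weight_branch A1 B1 U u1" "weight_branch A2 B2 U u2" "U \<inter> of_real ` (\<Delta>1 \<union> \<Delta>2) = {}" and z: "z \<in> U"
    for U u1 u2 z
  proof -
    have "U \<subseteq> - of_real ` \<Delta>1" "U \<subseteq> - of_real ` \<Delta>2" "z \<notin> of_real ` (\<Delta>1 \<union> \<Delta>2)" using br(3) z by auto
    hence hol: "h1 holomorphic_on U" "h2 holomorphic_on U" and off: "z \<notin> of_real ` (\<Delta>1 \<union> \<Delta>2)"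
      using holomorphic_on_subset[OF weighted_transform_holomorphic[OF w1]]
        holomorphic_on_subset[OF weighted_transform_holomorphic[OF w2]]
      unfolding h1_def h2_def \<Delta>1_def \<Delta>2_def by blast+
    have dP: "deriv (poly p) = poly (pderiv p)" for p :: "complex poly"
      by (auto simp: fun_eq_iff intro!: DERIV_imp_deriv poly_DERIV)
    note c1 = cleared_deriv_weight_branch[OF br(1) hol(1) z, folded poly_defs]
    note c2 = cleared_deriv_weight_branch[OF br(2) hol(2) z, folded poly_defs]
    show ?thesis
      unfolding R_eq[OF off] Wrons_3 dP q
      by (rule cleared_wronskian_eq[OF c1 c2])
  qed
  have swap: "Wrons [q2 u2, poly P, q1 u1] z = Wrons [poly P, q1 u1, q2 u2] z"
    "Wrons [q1 u1, poly P, q2 u2] z = - Wrons [poly P, q1 u1, q2 u2] z" for u1 u2 z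
    unfolding Wrons_3 by (simp_all add: algebra_simps)

  \<comment> \<open>the leading terms cancel in the formula by \<open>D\<close>, \<open>G\<close>, \<open>X\<close>; \<open>R_eq\<close> makes the decay of the transforms visible\<close>
  have degree: "int (degree R) \<le> 2 * class_index A1 B1 + 2 * class_index A2 B2 + 3"
  proof -
    define k where "k = 2 * class_index A1 B1 + 2 * class_index A2 B2 + 3"
    have "k \<ge> 0" using w1 w2 by (auto simp: semiclassical_weight_def k_def)
    define N where "N = int n1 + int n2"
    have deg: "int j \<le> N" if "coeff P j \<noteq> 0" for j
      using le_degree[OF that] \<open>degree P = n1 + n2\<close> by (simp add: N_def)
    have P_growth: "growth_le (poly P) N" "growth_le (poly (pderiv P)) (N - 1)" "growth_le (poly (pderiv (pderiv P))) (N - 2)"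
      using deg deg[of "Suc _"] deg[of "Suc (Suc _)"] by (fastforce intro!: growth_le_poly simp: coeff_pderiv)+
    have "growth_le (\<lambda>z. cleared_wronskian (poly P z) (poly (pderiv P) z) (poly (pderiv (pderiv P)) z)
      (poly a1 z) (h1 z) (cleared_deriv a1 b1 h1 z) (cleared_deriv2 a1 b1 h1 z)
      (poly a2 z) (h2 z) (cleared_deriv a2 b2 h2 z) (cleared_deriv2 a2 b2 h2 z)) k"
      unfolding k_def h1_def h2_def poly_defs \<Delta>1_def \<Delta>2_def
      by (rule growth_le_cleared_wronskian[OF P_growth growth_le_cpoly(1)[OF w1] growth_le_entries[OF w1 orth1]
            growth_le_cpoly(1)[OF w2] growth_le_entries[OF w2 orth2] N_def])
    then obtain C where C: "\<And>y. y \<ge> 1 \<Longrightarrow> norm (cleared_wronskian (poly P (\<i> * of_real y)) (poly (pderiv P) (\<i> * of_real y)) (poly (pderiv (pderiv P)) (\<i> * of_real y))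
      (poly a1 (\<i> * of_real y)) (h1 (\<i> * of_real y)) (cleared_deriv a1 b1 h1 (\<i> * of_real y)) (cleared_deriv2 a1 b1 h1 (\<i> * of_real y))
      (poly a2 (\<i> * of_real y)) (h2 (\<i> * of_real y)) (cleared_deriv a2 b2 h2 (\<i> * of_real y)) (cleared_deriv2 a2 b2 h2 (\<i> * of_real y))) \<le> C * y powi k"
      unfolding growth_le_def by blast
    have "growth_le (poly R) k"
    proof (rule growth_leI)
      fix y :: real assume y: "y \<ge> 1"
      have "\<i> * of_real y \<notin> of_real ` (\<Delta>1 \<union> \<Delta>2)" using y by (auto simp: complex_eq_iff)
      from R_eq[OF this] C[OF y] show "norm (poly R (\<i> * of_real y)) \<le> C * y powi k" by simp
    qed
    hence "degree R \<le> nat k" using \<open>k \<ge> 0\<close> by (intro degree_le_of_growth_le) simp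
    thus ?thesis using \<open>k \<ge> 0\<close> by (simp add: k_def[symmetric])
  qed

  have dvd1: "cpoly A1 dvd R" if "A1 = A2"
  proof -
    have "a2 = a1" using that by (simp add: poly_defs)
    hence "R = a1 * (P * (G1 * X2 - G2 * X1) - pderiv P * (a1 * D1 * X2 - a1 * D2 * X1)
              + pderiv (pderiv P) * (a1\<^sup>2 * D1 * G2 - a1\<^sup>2 * D2 * G1))"
      by (simp add: R_def cleared_wronskian_def power2_eq_square algebra_simps)
    thus ?thesis unfolding poly_defs by (rule dvdI)
  qed
  have dvd2: "(cpoly A1)\<^sup>2 dvd R" if "A1 = A2 \<and> B1 = B2"
  proof -
    have "a2 = a1" "b2 = b1" using that by (simp_all add: poly_defs)
    \<comment> \<open>the products \<open>(a' + b) G\<^sub>1 G\<^sub>2\<close> in \<open>G\<^sub>1 X\<^sub>2\<close> and \<open>G\<^sub>2 X\<^sub>1\<close> cancel, leaving a second factor \<open>a\<close>\<close>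
    hence "R = a1\<^sup>2 * (P * (G1 * K2 - G2 * K1) - pderiv P * (D1 * X2 - D2 * X1)
              + pderiv (pderiv P) * (a1 * D1 * G2 - a1 * D2 * G1))"
      by (simp add: R_def X1_def X2_def cleared_wronskian_def power2_eq_square algebra_simps)
    thus ?thesis unfolding poly_defs by (rule dvdI)
  qed

  show ?thesis
  proof (intro exI[of _ R] conjI allI impI ballI)
    fix U u1 u2 z
    assume "weight_branch A1 B1 U u1 \<and> weight_branch A2 B2 U u2 \<and> U \<inter> of_real ` (\<Delta>1 \<union> \<Delta>2) = {}" "z \<in> U"
    hence R: "poly R z = (poly (cpoly A1) z)\<^sup>2 * (poly (cpoly A2) z)\<^sup>2 * u1 z * u2 z * Wrons [poly P, q1 u1, q2 u2] z"
      using wronskian unfolding poly_defs by blast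
    show "poly R z = poly (cpoly A2) z * v_fun A2 u2 z * L_op A1 u1 P (q1 u1) (q2 u2) z"
      and "poly R z = - (poly (cpoly A1) z * v_fun A1 u1 z * L_op A2 u2 P (q2 u2) (q1 u1) z)"
      and "poly R z = poly (cpoly A1) z * poly (cpoly A2) z * v_fun A1 u1 z * v_fun A2 u2 z *
                         Wrons [poly P, q1 u1, q2 u2] z"
      unfolding R L_op_def swap v_fun_def by (simp_all add: power2_eq_square mult_ac)
  next
    fix U w z
    assume eq: "A1 = A2 \<and> B1 = B2"
      and "weight_branch A1 B1 U w \<and> U \<inter> of_real ` (\<Delta>1 \<union> \<Delta>2) = {}" and z: "z \<in> U"
    hence br: "weight_branch A1 B1 U w" "weight_branch A2 B2 U w" "U \<inter> of_real ` (\<Delta>1 \<union> \<Delta>2) = {}" by auto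
    have nz: "poly (cpoly A1) z \<noteq> 0" using br(1) z by (simp add: weight_branch_def)
    have "R = (R div (cpoly A1)\<^sup>2) * (cpoly A1)\<^sup>2" using dvd2[OF eq] by simp
    hence "poly R z = poly (R div (cpoly A1)\<^sup>2) z * (poly (cpoly A1) z)\<^sup>2"
      by (metis poly_mult poly_power)
    with wronskian[OF br z] eq
    have "poly (R div (cpoly A1)\<^sup>2) z * (poly (cpoly A1) z)\<^sup>2
        = (v_fun A1 w z)\<^sup>2 * Wrons [poly P, q1 w, q2 w] z * (poly (cpoly A1) z)\<^sup>2"
      by (simp add: poly_defs v_fun_def power2_eq_square mult_ac)
    thus "poly (R div (cpoly A1)\<^sup>2) z = (v_fun A1 w z)\<^sup>2 * Wrons [poly P, q1 w, q2 w] z"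
      using nz by simp
  qed (use degree dvd1 dvd2 in auto)
qed

end
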